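(* For every $\tau\in\mathbb{H}^2$ set $$u(\tau)=\frac{\eta^4(\tau)\,\eta^4(3\tau/2)\,\eta^4(6\tau)}{\eta^4(\tau/2)\,\eta^4(2\tau)\,\eta^4(3\tau)},\qquad U(\tau)=\frac{\eta^3(\tau/2)\,\eta^3(2\tau)\,\eta(3\tau)}{\eta^3(\tau)\,\eta(3\tau/2)\,\eta(6\tau)} .$$ Then the inverse function $\tau=\tau(u)$ yields $U(u)=U(\tau(u))$, and $U(u)$ satisfies Heun's differential equation $$\frac{d^2U}{du^2}+\left\{\frac1u+\frac{1}{u+1}+\frac{1}{u+\frac19}\right\}\frac{dU}{du}+\frac{u+\frac13}{u(u+1)\left(u+\frac19\right)}\,U=0 .$$
   Context: $\mathbb{H}^2=\{\tau\in\mathbb{C}\mid \Im\tau>0\}$; $\eta(\tau)=e^{2\pi i\tau/24}\prod_{n\ge1}(1-e^{2\pi i n\tau})$ is the Dedekind eta function and $\eta^k(r\tau)=(\eta(r\tau))^k$. The inverse function $\tau=\tau(u)$ means any local holomorphic inverse of $\tau\mapsto u(\tau)$; thus $U$ is regarded locally as a function of the variable $u$. *)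

theory Defs
  imports "HOL-Analysis.Analysis"
begin

definition upper_half_plane :: "complex set" where
  "upper_half_plane = {\<tau>. Im \<tau> > 0}"

(* The library's infinite product starts at index 0, hence the shift to Suc n. *)
definition dedekind_eta :: "complex \<Rightarrow> complex" where
  "dedekind_eta \<tau> = exp (2 * of_real pi * \<i> * \<tau> / 24) *
     (\<Prod>n. 1 - exp (2 * of_real pi * \<i> * of_nat (Suc n) * \<tau>))"

definition u_mod :: "complex \<Rightarrow> complex" where
  "u_mod \<tau> =
     (dedekind_eta \<tau> ^ 4 * dedekind_eta (3 * \<tau> / 2) ^ 4 * dedekind_eta (6 * \<tau>) ^ 4) /
     (dedekind_eta (\<tau> / 2) ^ 4 * dedekind_eta (2 * \<tau>) ^ 4 * dedekind_eta (3 * \<tau>) ^ 4)"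

definition U_mod :: "complex \<Rightarrow> complex" where
  "U_mod \<tau> =
     (dedekind_eta (\<tau> / 2) ^ 3 * dedekind_eta (2 * \<tau>) ^ 3 * dedekind_eta (3 * \<tau>)) /
     (dedekind_eta \<tau> ^ 3 * dedekind_eta (3 * \<tau> / 2) * dedekind_eta (6 * \<tau>))"

(* T is a local holomorphic inverse, defined on the open set W, of the restriction of f to
   the upper half-plane.  The condition f (T w) = w makes T injective, so T ` W is open and
   T inverts f on T ` W from both sides. *)
definition local_hol_inverse ::
  "(complex \<Rightarrow> complex) \<Rightarrow> (complex \<Rightarrow> complex) \<Rightarrow> complex set \<Rightarrow> bool" where
  "local_hol_inverse f T W \<longleftrightarrow>
     open W \<and> T holomorphic_on W \<and> T ` W \<subseteq> upper_half_plane \<and> (\<forall>w\<in>W. f (T w) = w)"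

(* The equation has singular coefficients at 0, -1, -1/9; a point where it holds is required to
   be none of these, so that division by zero plays no role. *)
definition heun_equation_at :: "(complex \<Rightarrow> complex) \<Rightarrow> complex \<Rightarrow> bool" where
  "heun_equation_at V w \<longleftrightarrow>
     w \<noteq> 0 \<and> w + 1 \<noteq> 0 \<and> w + 1 / 9 \<noteq> 0 \<and>
     deriv (deriv V) w + (1 / w + 1 / (w + 1) + 1 / (w + 1 / 9)) * deriv V w
       + (w + 1 / 3) / (w * (w + 1) * (w + 1 / 9)) * V w = 0"

end

theory Submission
  imports Defs "HOL-Complex_Analysis.Complex_Analysis"
begin

text \<open>
  Put \<open>D = 4 \<pi> \<i> d/d\<tau>\<close> and \<open>x = exp (\<pi> \<i> \<tau>)\<close>.  The functions \<open>u\<close> and \<open>U\<close> are quotients of values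
  of theta functions at \<open>0\<close> and at points of order three, such values satisfy a closed system of first-order
  differential equations in \<open>\<tau>\<close>, and Heun's equation is what remains when \<open>\<tau>\<close> is eliminated.

  Let \<open>s z\<close> be the even series \<open>\<Sum>n. x ^ n\<^sup>2 exp (2 \<pi> \<i> n z)\<close> and \<open>t z\<close> the odd theta function of the same
  lattice.  By the Jacobi triple product (theorem \<open>jacobi_triple_product\<close>)

    \<open>u = (t (1/3) / s (1/3)) ^ 4 / 9\<close>  and  \<open>U = sqrt 3 / (2 \<pi>) * t' 0 * s (1/3) / (t (1/3) * s 0)\<close>.

  Both series solve the heat equation, so that \<open>D\<close> acts on theta values as the second derivative in
  \<open>z\<close>.  It remains to find algebraic relations between the \<open>z\<close>-derivatives of \<open>s\<close> and \<open>t\<close> at \<open>0\<close> and \<open>1/3\<close>.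
  They all come from one source (lemma \<open>theta_mult_theta\<close>): there is a plane vector \<open>p z\<close>, formed by two
  theta functions of modulus \<open>2 \<tau>\<close>, such that \<open>s (u + v) * s (u - v)\<close> is the inner product and
  \<open>t (u + v) * t (u - v)\<close> the cross product of \<open>p u\<close> and \<open>p v\<close>.  The universal identities between inner
  and cross products of plane vectors, applied to \<open>p\<close> and its derivatives, give the following, where
  \<open>\<alpha> = s' (1/3) / s (1/3)\<close>, \<open>\<beta> = t' (1/3) / t (1/3)\<close>, \<open>\<xi> = s'' 0 / s 0\<close> and \<open>g = \<alpha> + 2 \<beta>\<close>.

    \<^item> \<open>g\<close> and \<open>\<alpha>\<close> are themselves theta quotients, whence \<open>U = sqrt 3 / (2 \<pi>) * g\<close> and \<open>u = - \<alpha> / (3 g)\<close>.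
    \<^item> The logarithmic derivatives of all theta values involved, and hence \<open>L = D U / U\<close>, are polynomials
      in \<open>\<alpha>\<close>, \<open>\<beta>\<close>, \<open>\<xi>\<close> (lemma \<open>heat_ratios\<close>).
    \<^item> \<open>D \<xi> = 2 \<xi>\<^sup>2 + 2 (t' 0 / s 0) ^ 4 = 2 \<xi>\<^sup>2 - 6 \<alpha> g ^ 3\<close> (lemma \<open>s_fourth_derivative_at_0\<close>).

  Expressing the results through \<open>u\<close> and \<open>U\<close> one finds

    \<open>D u = - 4 \<pi>\<^sup>2 u (1 + u) (1 + 9 u) U\<^sup>2\<close>,   \<open>D L = L\<^sup>2 - 48 \<pi> ^ 4 u (1 + u) (1 + 3 u) (1 + 9 u) U ^ 4\<close>.

  The first equation shows that \<open>u\<close> avoids \<open>0\<close>, \<open>-1\<close>, \<open>-1/9\<close> wherever it is locally invertible.  Dividing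
  by it turns \<open>D\<close> into \<open>d/du\<close>, so that \<open>u (1 + u) (1 + 9 u) dU/du = - L / (4 \<pi>\<^sup>2 U)\<close>, and by the second equation
  the derivative of the right-hand side with respect to \<open>u\<close> is \<open>- 3 (1 + 3 u) U\<close>.  This is Heun's
  equation in self-adjoint form.
\<close>

section \<open>Theta series and the heat equation\<close>

text \<open>
  The parameter \<open>k\<close> counts derivatives in \<open>z\<close>: \<open>theta k d\<close> is the termwise \<open>k\<close>-th derivative of
  \<open>theta 0 d\<close>.  The characteristic \<open>d\<close> is only used with the values \<open>0\<close> and \<open>1/2\<close>; the odd theta function
  is \<open>\<lambda>z. theta 0 (1/2) (z + 1/2) \<tau>\<close>, up to sign.
\<close>

definition theta_term :: "nat \<Rightarrow> real \<Rightarrow> complex \<Rightarrow> complex \<Rightarrow> int \<Rightarrow> complex" where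
  "theta_term k d z \<tau> n =
     (2 * pi * \<i> * (n + d)) ^ k * exp (pi * \<i> * (n + d)\<^sup>2 * \<tau> + 2 * pi * \<i> * (n + d) * z)"

definition theta :: "nat \<Rightarrow> real \<Rightarrow> complex \<Rightarrow> complex \<Rightarrow> complex" where
  "theta k d z \<tau> = (\<Sum>\<^sub>\<infinity>n. theta_term k d z \<tau> n)"

lemma norm_theta_term:
  "norm (theta_term k d z \<tau> n) =
     (2 * pi * \<bar>n + d\<bar>) ^ k * exp (- pi * (n + d)\<^sup>2 * Im \<tau> - 2 * pi * (n + d) * Im z)"
proof -
  have "norm (2 * pi * \<i> * (n + d)) = 2 * pi * \<bar>n + d\<bar>"
    by (simp only: norm_mult norm_of_real norm_ii) simp
  moreover have "Re (pi * \<i> * (n + d)\<^sup>2 * \<tau> + 2 * pi * \<i> * (n + d) * z) =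
      - pi * (n + d)\<^sup>2 * Im \<tau> - 2 * pi * (n + d) * Im z"
    by (simp add: algebra_simps)
  ultimately show ?thesis
    unfolding theta_term_def norm_mult norm_power norm_exp_eq_Re by simp
qed

lemma power_le_fact_exp:
  fixes x :: real
  assumes "x \<ge> 0"
  shows "x ^ k \<le> fact k * exp x"
proof -
  have "(\<Sum>n\<in>{k}. x ^ n /\<^sub>R fact n) \<le> (\<Sum>n. x ^ n /\<^sub>R fact n)"
    using assms by (intro sum_le_suminf summable_exp_generic) auto
  hence "x ^ k / fact k \<le> exp x"
    by (simp add: exp_def divide_inverse mult.commute)
  thus ?thesis by (simp add: field_simps)
qed

text \<open>
  The series runs over all integers, whereas the theorems on termwise differentiation concern series over
  the natural numbers; the bijection \<^const>\<open>int_decode\<close> mediates between the two.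
\<close>

lemma abs_int_decode_ge: "real m / 2 \<le> \<bar>real_of_int (int_decode m)\<bar>"
proof -
  have "int m \<le> 2 * \<bar>int_decode m\<bar>"
    by (auto simp: int_decode_def sum_decode_def split: sum.splits if_splits)
  thus ?thesis by linarith
qed

lemma summable_exp_neg_abs_int_decode: "summable (\<lambda>m. C * exp (- \<bar>real_of_int (int_decode m)\<bar>))"
proof (rule summable_mult, rule summable_comparison_test)
  show "summable (\<lambda>m. exp (-1/2) ^ m :: real)" by (rule summable_geometric) simp
  show "\<exists>N. \<forall>m\<ge>N. norm (exp (- \<bar>real_of_int (int_decode m)\<bar>)) \<le> exp (-1/2) ^ m"
    using abs_int_decode_ge by (auto simp flip: exp_of_nat_mult simp: field_simps)
qed

text \<open>
  The Gaussian factor dominates both the factor \<open>exp (2 \<pi> \<i> (n + d) z)\<close> and, after estimating powers by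
  an exponential, the polynomial factor.  The bound is uniform in \<open>z\<close> and in \<open>\<tau>\<close>, which gives locally uniform
  convergence in both variables at once.
\<close>

lemma theta_term_bound:
  fixes y R d :: real
  assumes "y > 0"
  obtains C where "\<And>z \<tau> n. Im \<tau> \<ge> y \<Longrightarrow> \<bar>Im z\<bar> \<le> R \<Longrightarrow>
    norm (theta_term k d z \<tau> n) \<le> C * exp (- \<bar>real_of_int n\<bar>)"
proof
  fix z \<tau> :: complex and n :: int
  assume \<tau>: "Im \<tau> \<ge> y" and z: "\<bar>Im z\<bar> \<le> R"
  define s c where "s = \<bar>n + d\<bar>" and "c = 2 * pi * R + 2 * pi + 1"
  have "s \<ge> 0" by (simp add: s_def)
  have "norm (theta_term k d z \<tau> n) \<le>
      (fact k * exp (2 * pi * s)) * exp (- pi * s\<^sup>2 * y + 2 * pi * s * R)"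
    unfolding norm_theta_term
  proof (intro mult_mono)
    show "(2 * pi * \<bar>n + d\<bar>) ^ k \<le> fact k * exp (2 * pi * s)"
      using power_le_fact_exp[of "2 * pi * s" k] \<open>s \<ge> 0\<close> by (simp add: s_def)
    have "pi * s\<^sup>2 * y \<le> pi * s\<^sup>2 * Im \<tau>"
      using \<tau> by (intro mult_left_mono) auto
    moreover have "\<bar>2 * pi * (n + d) * Im z\<bar> \<le> 2 * pi * s * R"
      unfolding abs_mult s_def using z by (intro mult_mono) auto
    ultimately have "- pi * (n + d)\<^sup>2 * Im \<tau> - 2 * pi * (n + d) * Im z
        \<le> - pi * s\<^sup>2 * y + 2 * pi * s * R"
      unfolding s_def power2_abs by linarith
    thus "exp (- pi * (n + d)\<^sup>2 * Im \<tau> - 2 * pi * (n + d) * Im z)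
        \<le> exp (- pi * s\<^sup>2 * y + 2 * pi * s * R)"
      by (simp only: exp_le_cancel_iff)
  qed auto
  also have "\<dots> = fact k * exp (c * s - pi * y * s\<^sup>2 - s)"
    by (simp add: c_def algebra_simps flip: exp_add)
  also have "\<dots> \<le> fact k * exp (c\<^sup>2 / (4 * pi * y) + \<bar>d\<bar> - \<bar>real_of_int n\<bar>)"
  proof -
    \<comment> \<open>Completing the square in \<open>s\<close>.\<close>
    have "0 \<le> pi * y * (s - c / (2 * pi * y))\<^sup>2"
      using assms by simp
    also have "\<dots> = pi * y * s\<^sup>2 - c * s + c\<^sup>2 / (4 * pi * y)"
      using assms by (simp add: power2_eq_square field_simps)
    finally have "c * s - pi * y * s\<^sup>2 \<le> c\<^sup>2 / (4 * pi * y)" by simp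
    moreover have "\<bar>real_of_int n\<bar> \<le> \<bar>d\<bar> + s" unfolding s_def by linarith
    ultimately show ?thesis by simp
  qed
  finally show "norm (theta_term k d z \<tau> n) \<le>
      (fact k * exp ((2 * pi * R + 2 * pi + 1)\<^sup>2 / (4 * pi * y) + \<bar>d\<bar>)) * exp (- \<bar>real_of_int n\<bar>)"
    by (simp add: c_def exp_add exp_diff exp_minus field_simps)
qed

lemma has_sum_int_decode:
  fixes f :: "int \<Rightarrow> 'a :: banach"
  assumes "summable (\<lambda>m. norm (f (int_decode m)))"
  shows "((\<lambda>n. f n) has_sum (\<Sum>m. f (int_decode m))) UNIV"
proof -
  have "((\<lambda>m. f (int_decode m)) has_sum (\<Sum>m. f (int_decode m))) UNIV"
    by (rule norm_summable_imp_has_sum[OF assms summable_sums[OF summable_norm_cancel[OF assms]]])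
  thus ?thesis
    by (rule iffD1[OF has_sum_reindex_bij_betw[OF bij_int_decode, of f]])
qed

context
  fixes \<tau> :: complex
  assumes \<tau>: "Im \<tau> > 0"
begin

lemma summable_theta_term: "summable (\<lambda>m. norm (theta_term k d z \<tau> (int_decode m)))"
proof -
  obtain C where C: "\<And>w t n. Im t \<ge> Im \<tau> \<Longrightarrow> \<bar>Im w\<bar> \<le> \<bar>Im z\<bar> \<Longrightarrow>
    norm (theta_term k d w t n) \<le> C * exp (- \<bar>real_of_int n\<bar>)"
    using theta_term_bound[OF \<tau>] by blast
  show ?thesis
  proof (rule summable_comparison_test'[where N = 0])
    show "summable (\<lambda>m. C * exp (- \<bar>real_of_int (int_decode m)\<bar>))"
      by (rule summable_exp_neg_abs_int_decode)
    show "norm (norm (theta_term k d z \<tau> (int_decode m)))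
        \<le> C * exp (- \<bar>real_of_int (int_decode m)\<bar>)" for m
      using C[of \<tau> z "int_decode m"] by simp
  qed
qed

lemma abs_summable_theta_term: "(\<lambda>n. norm (theta_term k d z \<tau> n)) summable_on UNIV"
  using has_sum_int_decode[of "\<lambda>n. norm (theta_term k d z \<tau> n)"] summable_theta_term[of k d z]
    has_sum_imp_summable[of "\<lambda>n. norm (theta_term k d z \<tau> n)"] by simp

lemma theta_has_sum: "((\<lambda>n. theta_term k d z \<tau> n) has_sum theta k d z \<tau>) UNIV"
proof -
  note sum = has_sum_int_decode[of "theta_term k d z \<tau>", OF summable_theta_term]
  show ?thesis unfolding theta_def infsumI[OF sum] by (rule sum)
qed

lemma theta_sums: "(\<lambda>m. theta_term k d z \<tau> (int_decode m)) sums theta k d z \<tau>"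
  using theta_has_sum[of k d z]
    has_sum_reindex_bij_betw[OF bij_int_decode, of "theta_term k d z \<tau>" "theta k d z \<tau>"]
  by (intro has_sum_imp_sums) (simp only:)

end

lemma DERIV_theta:
  assumes "Im \<tau> > 0"
  shows "((\<lambda>z. theta k d z \<tau>) has_field_derivative theta (Suc k) d z \<tau>) (at z)"
proof -
  obtain C where C: "\<And>w t n. Im t \<ge> Im \<tau> \<Longrightarrow> \<bar>Im w\<bar> \<le> \<bar>Im z\<bar> + 1 \<Longrightarrow>
    norm (theta_term k d w t n) \<le> C * exp (- \<bar>real_of_int n\<bar>)"
    using theta_term_bound[OF assms] by blast
  obtain g g' where g: "\<forall>w \<in> ball z 1. (\<lambda>m. theta_term k d w \<tau> (int_decode m)) sums g w \<and>
      (\<lambda>m. theta_term (Suc k) d w \<tau> (int_decode m)) sums g' w \<and> (g has_field_derivative g' w) (at w)"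
  proof (rule series_and_derivative_comparison[of "ball z 1",
        OF _ summable_exp_neg_abs_int_decode[of C]])
    fix m w
    show "((\<lambda>w. theta_term k d w \<tau> (int_decode m)) has_field_derivative
        theta_term (Suc k) d w \<tau> (int_decode m)) (at w)"
      unfolding theta_term_def
      by (rule derivative_eq_intros refl | simp)+
  next
    have "\<bar>Im w\<bar> \<le> \<bar>Im z\<bar> + 1" if "w \<in> ball z 1" for w
      using that abs_Im_le_cmod[of "w - z"] by (simp add: dist_norm norm_minus_commute)
    thus "\<forall>\<^sub>F m in sequentially. \<forall>w\<in>ball z 1.
        norm (theta_term k d w \<tau> (int_decode m)) \<le> C * exp (- \<bar>real_of_int (int_decode m)\<bar>)"
      using C by (intro always_eventually) auto
  qed auto
  have "g w = theta k d w \<tau>" if "w \<in> ball z 1" for w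
    using g that sums_unique2[OF _ theta_sums[OF assms]] by blast
  moreover have "g' z = theta (Suc k) d z \<tau>"
    using g sums_unique2[OF _ theta_sums[OF assms]] by force
  moreover have "(g has_field_derivative g' z) (at z)"
    using g by simp
  ultimately show ?thesis
    using has_field_derivative_transform_within_open[of g "g' z" z "ball z 1"] by simp
qed

text \<open>
  Differentiating the \<open>n\<close>-th term once in \<open>\<tau>\<close> multiplies it by \<open>\<pi> \<i> (n + d)\<^sup>2\<close>, differentiating it twice in \<open>z\<close>
  multiplies it by \<open>(2 \<pi> \<i> (n + d))\<^sup>2\<close>.
\<close>

lemma heat_equation_theta:
  assumes "Im \<tau> > 0"
  shows "((\<lambda>\<tau>. theta k d z \<tau>) has_field_derivative theta (k + 2) d z \<tau> / (4 * pi * \<i>)) (at \<tau>)"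
proof -
  define y where "y = Im \<tau> / 2"
  have y: "y > 0" using assms by (simp add: y_def)
  obtain C where C: "\<And>w t n. Im t \<ge> y \<Longrightarrow> \<bar>Im w\<bar> \<le> \<bar>Im z\<bar> \<Longrightarrow>
    norm (theta_term k d w t n) \<le> C * exp (- \<bar>real_of_int n\<bar>)"
    using theta_term_bound[OF y] by blast
  have im: "Im t \<ge> y" if "t \<in> ball \<tau> y" for t
    using that abs_Im_le_cmod[of "\<tau> - t"] by (simp add: dist_norm y_def)
  obtain g g' where g: "\<forall>t \<in> ball \<tau> y. (\<lambda>m. theta_term k d z t (int_decode m)) sums g t \<and>
      (\<lambda>m. theta_term (k + 2) d z t (int_decode m) / (4 * pi * \<i>)) sums g' t \<and>
      (g has_field_derivative g' t) (at t)"
  proof (rule series_and_derivative_comparison[of "ball \<tau> y",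
        OF _ summable_exp_neg_abs_int_decode[of C]])
    fix m t
    show "((\<lambda>t. theta_term k d z t (int_decode m)) has_field_derivative
        theta_term (k + 2) d z t (int_decode m) / (4 * pi * \<i>)) (at t)"
    proof -
      define c where "c = 2 * pi * \<i> * (int_decode m + d)"
      have c: "pi * \<i> * (int_decode m + d)\<^sup>2 = c\<^sup>2 / (4 * pi * \<i>)"
        by (simp add: c_def power2_eq_square)
      show ?thesis
        unfolding theta_term_def c c_def[symmetric]
        by (rule derivative_eq_intros refl | simp add: power_add power2_eq_square)+
    qed
  next
    show "\<forall>\<^sub>F m in sequentially. \<forall>t\<in>ball \<tau> y.
        norm (theta_term k d z t (int_decode m)) \<le> C * exp (- \<bar>real_of_int (int_decode m)\<bar>)"
      using C im by (intro always_eventually) auto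
  qed auto
  have "g t = theta k d z t" if "t \<in> ball \<tau> y" for t
    using g that sums_unique2[OF _ theta_sums] im[OF that] y by force
  moreover have "g' \<tau> = theta (k + 2) d z \<tau> / (4 * pi * \<i>)"
    using g y sums_unique2[OF _ sums_divide[OF theta_sums[OF assms]]] by force
  moreover have "(g has_field_derivative g' \<tau>) (at \<tau>)"
    using g y by simp
  ultimately show ?thesis
    using has_field_derivative_transform_within_open[of g "g' \<tau>" \<tau> "ball \<tau> y"] y by simp
qed

section \<open>Symmetries and bilinear relations\<close>

lemma theta_minus:
  assumes "2 * d = of_int m"
  shows "theta k d (- z) \<tau> = (-1) ^ k * theta k d z \<tau>"
proof -
  have "theta_term k d (- z) \<tau> n = (-1) ^ k * theta_term k d z \<tau> (- n - m)" for n
  proof -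
    define s where "s = complex_of_int n + d"
    have s: "of_int (- n - m) + complex_of_real d = - s"
      using arg_cong[OF assms, of complex_of_real] by (simp add: s_def algebra_simps)
    have "(-1) ^ k * (2 * pi * \<i> * - s) ^ k = (2 * pi * \<i> * s) ^ k"
      unfolding power_mult_distrib[symmetric] by simp
    thus ?thesis
      unfolding theta_term_def s s_def[symmetric] mult.assoc[of "(-1) ^ k", symmetric] by simp
  qed
  hence "theta k d (- z) \<tau> = (\<Sum>\<^sub>\<infinity>n. (-1) ^ k * theta_term k d z \<tau> (- n - m))"
    unfolding theta_def by (intro infsum_cong)
  also have "\<dots> = (-1) ^ k * (\<Sum>\<^sub>\<infinity>n. theta_term k d z \<tau> (- n - m))"
    by (rule infsum_cmult_right')
  also have "(\<Sum>\<^sub>\<infinity>n. theta_term k d z \<tau> (- n - m)) = theta k d z \<tau>"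
    unfolding theta_def
    by (rule infsum_reindex_bij_witness[where i = "\<lambda>n. - n - m" and j = "\<lambda>n. - n - m"]) auto
  finally show ?thesis .
qed

lemma theta_plus_1: "theta k d (z + 1) \<tau> = exp (2 * pi * \<i> * d) * theta k d z \<tau>"
proof -
  have "theta_term k d (z + 1) \<tau> n = exp (2 * pi * \<i> * d) * theta_term k d z \<tau> n" for n
  proof -
    have "exp (pi * \<i> * (n + d)\<^sup>2 * \<tau> + 2 * pi * \<i> * (n + d) * (z + 1)) =
        exp ((2 * pi * \<i> * d + (pi * \<i> * (n + d)\<^sup>2 * \<tau> + 2 * pi * \<i> * (n + d) * z))
          + \<i> * (of_int n * (of_real pi * 2)))"
      by (simp add: algebra_simps)
    thus ?thesis
      unfolding theta_term_def exp_plus_2pin by (simp add: exp_add)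
  qed
  hence "theta_term k d (z + 1) \<tau> = (\<lambda>n. exp (2 * pi * \<i> * d) * theta_term k d z \<tau> n)"
    by blast
  thus ?thesis
    unfolding theta_def by (simp only: infsum_cmult_right')
qed

lemma infsum_times:
  fixes f :: "'a \<Rightarrow> complex" and g :: "'b \<Rightarrow> complex"
  assumes f: "(\<lambda>i. norm (f i)) summable_on UNIV" and g: "(\<lambda>i. norm (g i)) summable_on UNIV"
  shows "(\<lambda>(i, j). f i * g j) summable_on UNIV"
    and "(\<Sum>\<^sub>\<infinity>(i, j). f i * g j) = infsum f UNIV * infsum g UNIV"
proof -
  have "(\<lambda>p. norm (case p of (i, j) \<Rightarrow> f i * g j)) summable_on (UNIV \<times> UNIV)"
    using summable_on_cmult_right[OF g] summable_on_cmult_left[OF f]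
    by (intro iffD2[OF Infinite_Sum.abs_summable_on_Sigma_iff])
       (simp add: norm_mult infsum_cmult_right' infsum_nonneg)
  thus *: "(\<lambda>(i, j). f i * g j) summable_on UNIV"
    using abs_summable_summable by force
  have "(\<Sum>\<^sub>\<infinity>(i, j). f i * g j) = (\<Sum>\<^sub>\<infinity>i. \<Sum>\<^sub>\<infinity>j. f i * g j)"
    using infsum_Sigma'_banach[of "\<lambda>i j. f i * g j" UNIV "\<lambda>_. UNIV"] * by simp
  also have "\<dots> = infsum f UNIV * infsum g UNIV"
    by (simp add: infsum_cmult_right' infsum_cmult_left')
  finally show "(\<Sum>\<^sub>\<infinity>(i, j). f i * g j) = infsum f UNIV * infsum g UNIV" .
qed

text \<open>
  Pairs of integers of equal parity are exactly the pairs \<open>(k + l, k - l)\<close>, those of different parity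
  exactly the pairs \<open>(k + l + 1, k - l)\<close>.
\<close>

lemma infsum_split_parity:
  fixes g :: "int \<times> int \<Rightarrow> complex"
  assumes "g summable_on UNIV"
  shows "infsum g UNIV = (\<Sum>\<^sub>\<infinity>(k, l). g (k + l, k - l)) + (\<Sum>\<^sub>\<infinity>(k, l). g (k + l + 1, k - l))"
proof -
  define E where "E = {(m, n :: int). even (m + n)}"
  have even_halves: "(m + n) div 2 + (m - n) div 2 = m" "(m + n) div 2 - (m - n) div 2 = n"
    if "even (m + n)" for m n :: int
    using that by presburger+
  have odd_halves: "(m + n) div 2 + (m - n) div 2 + 1 = m" "(m + n) div 2 - (m - n) div 2 = n"
    if "odd (m + n)" for m n :: int
    using that by presburger+
  have "infsum g UNIV = infsum g (E \<union> - E)" by simp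
  also have "\<dots> = infsum g E + infsum g (- E)"
    by (rule infsum_Un_disjoint) (auto intro: summable_on_subset_banach[OF assms])
  also have "infsum g E = (\<Sum>\<^sub>\<infinity>(k, l). g (k + l, k - l))"
    by (rule infsum_reindex_bij_witness[where j = "\<lambda>(m, n). ((m + n) div 2, (m - n) div 2)"
          and i = "\<lambda>(k, l). (k + l, k - l)"])
       (auto simp: E_def even_halves)
  also have "infsum g (- E) = (\<Sum>\<^sub>\<infinity>(k, l). g (k + l + 1, k - l))"
    by (rule infsum_reindex_bij_witness[where j = "\<lambda>(m, n). ((m + n) div 2, (m - n) div 2)"
          and i = "\<lambda>(k, l). (k + l + 1, k - l)"])
       (auto simp: E_def odd_halves simp del: even_add odd_add)
  finally show ?thesis .
qed

text \<open>
  In the product of the two series the exponents are \<open>\<pi> \<i> (\<mu>\<^sup>2 + \<nu>\<^sup>2) \<tau> + 2 \<pi> \<i> ((\<mu> + \<nu>) u + (\<mu> - \<nu>) v)\<close>.  With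
  \<open>\<mu> = k + l\<close> and \<open>\<nu> = k - l\<close> they become \<open>2 \<pi> \<i> (k\<^sup>2 + l\<^sup>2) \<tau> + 4 \<pi> \<i> (k u + l v)\<close>, which separates \<open>u\<close> from \<open>v\<close>; here
  \<open>k\<close> and \<open>l\<close> range over integers and half-integers, and splitting by parity produces the two
  summands.
\<close>

lemma theta_mult_theta:
  fixes u v \<tau> :: complex
  assumes \<tau>: "Im \<tau> > 0"
  defines "p \<equiv> \<lambda>d z. theta 0 d (2 * z) (2 * \<tau>)"
  shows "theta 0 0 (u + v) \<tau> * theta 0 0 (u - v) \<tau> = p 0 u * p 0 v + p (1/2) u * p (1/2) v"
    and "theta 0 (1/2) (u + v + 1/2) \<tau> * theta 0 (1/2) (u - v + 1/2) \<tau> =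
           p 0 u * p (1/2) v - p (1/2) u * p 0 v"
proof -
  have \<tau>2: "Im (2 * \<tau>) > 0" using \<tau> by simp
  note sum = abs_summable_theta_term[OF \<tau>] and sum2 = abs_summable_theta_term[OF \<tau>2]
  define T where "T = (\<lambda>d z n. theta_term 0 d (2 * z) (2 * \<tau>) n)"
  have p: "p d z * p d' z' = (\<Sum>\<^sub>\<infinity>(k, l). T d z k * T d' z' l)" for d d' z z'
    unfolding p_def T_def theta_def infsum_times(2)[OF sum2 sum2] ..
  have shift: "(\<Sum>\<^sub>\<infinity>(k, l). T d z (k + 1) * T d' z' l) = p d z * p d' z'" for d d' z z'
    unfolding p
    by (rule infsum_reindex_bij_witness[where j = "\<lambda>(k, l). (k + 1, l)" and i = "\<lambda>(k, l). (k - 1, l)"])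
       auto
  have "theta 0 0 (u + v) \<tau> * theta 0 0 (u - v) \<tau> =
      (\<Sum>\<^sub>\<infinity>(m, n). theta_term 0 0 (u + v) \<tau> m * theta_term 0 0 (u - v) \<tau> n)"
    unfolding theta_def infsum_times(2)[OF sum sum] ..
  also have "\<dots> = (\<Sum>\<^sub>\<infinity>(k, l). T 0 u k * T 0 v l) + (\<Sum>\<^sub>\<infinity>(k, l). T (1/2) u k * T (1/2) v l)"
    unfolding infsum_split_parity[OF infsum_times(1)[OF sum sum]]
  proof (intro arg_cong2[where f = "(+)"] infsum_cong; clarify)
    fix k l :: int
    show "theta_term 0 0 (u + v) \<tau> (k + l) * theta_term 0 0 (u - v) \<tau> (k - l) = T 0 u k * T 0 v l"
      unfolding T_def theta_term_def power_0 mult_1_left exp_add[symmetric]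
      by (rule arg_cong[where f = exp]) (simp add: power2_eq_square algebra_simps)
    show "theta_term 0 0 (u + v) \<tau> (k + l + 1) * theta_term 0 0 (u - v) \<tau> (k - l) =
        T (1/2) u k * T (1/2) v l"
      unfolding T_def theta_term_def power_0 mult_1_left exp_add[symmetric]
      by (rule arg_cong[where f = exp]) (simp add: power2_eq_square algebra_simps)
  qed
  finally show "theta 0 0 (u + v) \<tau> * theta 0 0 (u - v) \<tau> = p 0 u * p 0 v + p (1/2) u * p (1/2) v"
    unfolding p .
  have "theta 0 (1/2) (u + v + 1/2) \<tau> * theta 0 (1/2) (u - v + 1/2) \<tau> =
      (\<Sum>\<^sub>\<infinity>(m, n). theta_term 0 (1/2) (u + v + 1/2) \<tau> m * theta_term 0 (1/2) (u - v + 1/2) \<tau> n)"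
    unfolding theta_def infsum_times(2)[OF sum sum] ..
  also have "\<dots> = (\<Sum>\<^sub>\<infinity>(k, l). - (T (1/2) u k * T 0 v l)) + (\<Sum>\<^sub>\<infinity>(k, l). T 0 u (k + 1) * T (1/2) v l)"
    unfolding infsum_split_parity[OF infsum_times(1)[OF sum sum]]
  proof (intro arg_cong2[where f = "(+)"] infsum_cong; clarify)
    fix k l :: int
    \<comment> \<open>The summands \<open>1/2\<close> in the arguments contribute the sign \<open>exp (\<pi> \<i> (\<mu> + \<nu>))\<close>.\<close>
    have "theta_term 0 (1/2) (u + v + 1/2) \<tau> (k + l) * theta_term 0 (1/2) (u - v + 1/2) \<tau> (k - l) =
        T (1/2) u k * T 0 v l * exp (\<i> * pi + \<i> * (of_int k * (of_real pi * 2)))"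
      unfolding T_def theta_term_def power_0 mult_1_left exp_add[symmetric]
      by (rule arg_cong[where f = exp]) (simp add: power2_eq_square algebra_simps)
    thus "theta_term 0 (1/2) (u + v + 1/2) \<tau> (k + l) * theta_term 0 (1/2) (u - v + 1/2) \<tau> (k - l) =
        - (T (1/2) u k * T 0 v l)"
      unfolding exp_plus_2pin by simp
    have "theta_term 0 (1/2) (u + v + 1/2) \<tau> (k + l + 1) * theta_term 0 (1/2) (u - v + 1/2) \<tau> (k - l) =
        T 0 u (k + 1) * T (1/2) v l * exp (0 + \<i> * (of_int (k + 1) * (of_real pi * 2)))"
      unfolding T_def theta_term_def power_0 mult_1_left exp_add[symmetric]
      by (rule arg_cong[where f = exp]) (simp add: power2_eq_square algebra_simps)
    thus "theta_term 0 (1/2) (u + v + 1/2) \<tau> (k + l + 1) * theta_term 0 (1/2) (u - v + 1/2) \<tau> (k - l) =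
        T 0 u (k + 1) * T (1/2) v l"
      unfolding exp_plus_2pin by simp
  qed
  also have "\<dots> = - (p (1/2) u * p 0 v) + p 0 u * p (1/2) v"
    unfolding shift p by (simp add: case_prod_unfold infsum_uminus)
  finally show "theta 0 (1/2) (u + v + 1/2) \<tau> * theta 0 (1/2) (u - v + 1/2) \<tau> =
      p 0 u * p (1/2) v - p (1/2) u * p 0 v" by simp
qed

section \<open>Relations between a pair of theta functions\<close>

context
  fixes f :: "nat \<Rightarrow> complex \<Rightarrow> complex"
  assumes DERIV_f: "\<And>k z. (f k has_field_derivative f (Suc k) z) (at z)"
begin

lemma DERIV_times_sum_diff_left:
  "((\<lambda>u. f i (u + v) * f j (u - v)) has_field_derivative
     f (Suc i) (u + v) * f j (u - v) + f i (u + v) * f (Suc j) (u - v)) (at u)"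
  by (rule derivative_eq_intros DERIV_chain2[OF DERIV_f] refl | simp)+

lemma DERIV_times_sum_diff_right:
  "((\<lambda>v. f i (u + v) * f j (u - v)) has_field_derivative
     f (Suc i) (u + v) * f j (u - v) - f i (u + v) * f (Suc j) (u - v)) (at v)"
  by (rule derivative_eq_intros DERIV_chain2[OF DERIV_f] refl | simp)+

end

text \<open>
  This captures what is used of the even theta function \<open>s\<close>, the odd theta function \<open>t\<close> and the vector
  \<open>(A, B)\<close> of theta functions of doubled modulus.  The first argument counts derivatives.
\<close>

locale theta_pair =
  fixes s t A B :: "nat \<Rightarrow> complex \<Rightarrow> complex"
  assumes DERIV_s: "\<And>k z. (s k has_field_derivative s (Suc k) z) (at z)"
    and DERIV_t: "\<And>k z. (t k has_field_derivative t (Suc k) z) (at z)"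
    and DERIV_A: "\<And>k z. (A k has_field_derivative A (Suc k) z) (at z)"
    and DERIV_B: "\<And>k z. (B k has_field_derivative B (Suc k) z) (at z)"
    and s_minus: "\<And>k z. s k (- z) = (-1) ^ k * s k z"
    and t_minus: "\<And>k z. t k (- z) = - ((-1) ^ k * t k z)"
    and s_plus_1: "\<And>k z. s k (z + 1) = s k z"
    and t_plus_1: "\<And>k z. t k (z + 1) = - t k z"
    and s_times_s: "\<And>u v. s 0 (u + v) * s 0 (u - v) = A 0 u * A 0 v + B 0 u * B 0 v"
    and t_times_t: "\<And>u v. t 0 (u + v) * t 0 (u - v) = A 0 u * B 0 v - B 0 u * A 0 v"
begin

lemmas DERIV_s_times_s =
  DERIV_times_sum_diff_left[of s, OF DERIV_s] DERIV_times_sum_diff_right[of s, OF DERIV_s]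

lemmas DERIV_t_times_t =
  DERIV_times_sum_diff_left[of t, OF DERIV_t] DERIV_times_sum_diff_right[of t, OF DERIV_t]

lemma t_even_at_0: "even k \<Longrightarrow> t k 0 = 0"
  using t_minus[of k 0] by (simp add: eq_neg_iff_add_eq_0)

lemma s_odd_at_0: "odd k \<Longrightarrow> s k 0 = 0"
  using s_minus[of k 0] by (simp add: eq_neg_iff_add_eq_0)

lemma s_two_thirds: "s k (2/3) = (-1) ^ k * s k (1/3)"
  using s_plus_1[of k "-1/3"] s_minus[of k "1/3"] by simp

lemma t_two_thirds: "t k (2/3) = (-1) ^ k * t k (1/3)"
  using t_plus_1[of k "-1/3"] t_minus[of k "1/3"] by simp

text \<open>
  The lemmas \<open>dot_ij\<close> and \<open>cross_ij\<close> arise from the two product formulas by differentiating \<open>i\<close> times in \<open>u\<close> and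
  \<open>j\<close> times in \<open>v\<close>: they express the inner and cross products of the \<open>i\<close>-th derivative of \<open>(A, B)\<close> at \<open>u\<close> with the
  \<open>j\<close>-th derivative at \<open>v\<close>.
\<close>

lemma dot_10:
  "s 1 (u + v) * s 0 (u - v) + s 0 (u + v) * s 1 (u - v) = A 1 u * A 0 v + B 1 u * B 0 v"
proof (rule DERIV_unique)
  show "((\<lambda>u. s 0 (u + v) * s 0 (u - v)) has_field_derivative
      s 1 (u + v) * s 0 (u - v) + s 0 (u + v) * s 1 (u - v)) (at u)"
    using DERIV_s_times_s(1)[of 0 v 0 u] by simp
  show "((\<lambda>u. s 0 (u + v) * s 0 (u - v)) has_field_derivative A 1 u * A 0 v + B 1 u * B 0 v) (at u)"
    unfolding s_times_s
    by (rule derivative_eq_intros DERIV_A DERIV_B refl | simp)+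
qed

lemma dot_20:
  "s 2 (u + v) * s 0 (u - v) + 2 * (s 1 (u + v) * s 1 (u - v)) + s 0 (u + v) * s 2 (u - v)
     = A 2 u * A 0 v + B 2 u * B 0 v"
proof (rule DERIV_unique)
  show "((\<lambda>u. s 1 (u + v) * s 0 (u - v) + s 0 (u + v) * s 1 (u - v)) has_field_derivative
      s 2 (u + v) * s 0 (u - v) + 2 * (s 1 (u + v) * s 1 (u - v)) + s 0 (u + v) * s 2 (u - v)) (at u)"
    using DERIV_add[OF DERIV_s_times_s(1)[of 1 v 0 u] DERIV_s_times_s(1)[of 0 v 1 u]]
    by (simp add: numeral_2_eq_2 algebra_simps)
  show "((\<lambda>u. s 1 (u + v) * s 0 (u - v) + s 0 (u + v) * s 1 (u - v)) has_field_derivative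
      A 2 u * A 0 v + B 2 u * B 0 v) (at u)"
    unfolding dot_10
    by (rule derivative_eq_intros DERIV_A DERIV_B refl | simp add: numeral_2_eq_2)+
qed

lemma dot_21:
  "s 3 (u + v) * s 0 (u - v) + s 2 (u + v) * s 1 (u - v) - s 1 (u + v) * s 2 (u - v)
     - s 0 (u + v) * s 3 (u - v) = A 2 u * A 1 v + B 2 u * B 1 v"
proof (rule DERIV_unique)
  show "((\<lambda>v. s 2 (u + v) * s 0 (u - v) + 2 * (s 1 (u + v) * s 1 (u - v)) + s 0 (u + v) * s 2 (u - v))
      has_field_derivative s 3 (u + v) * s 0 (u - v) + s 2 (u + v) * s 1 (u - v)
        - s 1 (u + v) * s 2 (u - v) - s 0 (u + v) * s 3 (u - v)) (at v)"
    using DERIV_add[OF DERIV_add[OF DERIV_s_times_s(2)[of 2 u 0 v]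
          DERIV_cmult[OF DERIV_s_times_s(2)[of 1 u 1 v], of 2]] DERIV_s_times_s(2)[of 0 u 2 v]]
    by (simp add: eval_nat_numeral algebra_simps)
  show "((\<lambda>v. s 2 (u + v) * s 0 (u - v) + 2 * (s 1 (u + v) * s 1 (u - v)) + s 0 (u + v) * s 2 (u - v))
      has_field_derivative A 2 u * A 1 v + B 2 u * B 1 v) (at v)"
    unfolding dot_20
    by (rule derivative_eq_intros DERIV_A DERIV_B refl | simp)+
qed

lemma dot_22:
  "s 4 (u + v) * s 0 (u - v) - 2 * (s 2 (u + v) * s 2 (u - v)) + s 0 (u + v) * s 4 (u - v)
     = A 2 u * A 2 v + B 2 u * B 2 v"
proof (rule DERIV_unique)
  show "((\<lambda>v. s 3 (u + v) * s 0 (u - v) + s 2 (u + v) * s 1 (u - v) - s 1 (u + v) * s 2 (u - v)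
      - s 0 (u + v) * s 3 (u - v)) has_field_derivative
      s 4 (u + v) * s 0 (u - v) - 2 * (s 2 (u + v) * s 2 (u - v)) + s 0 (u + v) * s 4 (u - v)) (at v)"
    using DERIV_diff[OF DERIV_diff[OF DERIV_add[OF DERIV_s_times_s(2)[of 3 u 0 v]
          DERIV_s_times_s(2)[of 2 u 1 v]] DERIV_s_times_s(2)[of 1 u 2 v]] DERIV_s_times_s(2)[of 0 u 3 v]]
    by (simp add: eval_nat_numeral algebra_simps)
  show "((\<lambda>v. s 3 (u + v) * s 0 (u - v) + s 2 (u + v) * s 1 (u - v) - s 1 (u + v) * s 2 (u - v)
      - s 0 (u + v) * s 3 (u - v)) has_field_derivative A 2 u * A 2 v + B 2 u * B 2 v) (at v)"
    unfolding dot_21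
    by (rule derivative_eq_intros DERIV_A DERIV_B refl | simp add: numeral_2_eq_2)+
qed

lemma cross_10:
  "t 1 (u + v) * t 0 (u - v) + t 0 (u + v) * t 1 (u - v) = A 1 u * B 0 v - B 1 u * A 0 v"
proof (rule DERIV_unique)
  show "((\<lambda>u. t 0 (u + v) * t 0 (u - v)) has_field_derivative
      t 1 (u + v) * t 0 (u - v) + t 0 (u + v) * t 1 (u - v)) (at u)"
    using DERIV_t_times_t(1)[of 0 v 0 u] by simp
  show "((\<lambda>u. t 0 (u + v) * t 0 (u - v)) has_field_derivative A 1 u * B 0 v - B 1 u * A 0 v) (at u)"
    unfolding t_times_t
    by (rule derivative_eq_intros DERIV_A DERIV_B refl | simp)+
qed

lemma cross_20:
  "t 2 (u + v) * t 0 (u - v) + 2 * (t 1 (u + v) * t 1 (u - v)) + t 0 (u + v) * t 2 (u - v)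
     = A 2 u * B 0 v - B 2 u * A 0 v"
proof (rule DERIV_unique)
  show "((\<lambda>u. t 1 (u + v) * t 0 (u - v) + t 0 (u + v) * t 1 (u - v)) has_field_derivative
      t 2 (u + v) * t 0 (u - v) + 2 * (t 1 (u + v) * t 1 (u - v)) + t 0 (u + v) * t 2 (u - v)) (at u)"
    using DERIV_add[OF DERIV_t_times_t(1)[of 1 v 0 u] DERIV_t_times_t(1)[of 0 v 1 u]]
    by (simp add: numeral_2_eq_2 algebra_simps)
  show "((\<lambda>u. t 1 (u + v) * t 0 (u - v) + t 0 (u + v) * t 1 (u - v)) has_field_derivative
      A 2 u * B 0 v - B 2 u * A 0 v) (at u)"
    unfolding cross_10
    by (rule derivative_eq_intros DERIV_A DERIV_B refl | simp add: numeral_2_eq_2)+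
qed

lemma cross_21:
  "t 3 (u + v) * t 0 (u - v) + t 2 (u + v) * t 1 (u - v) - t 1 (u + v) * t 2 (u - v)
     - t 0 (u + v) * t 3 (u - v) = A 2 u * B 1 v - B 2 u * A 1 v"
proof (rule DERIV_unique)
  show "((\<lambda>v. t 2 (u + v) * t 0 (u - v) + 2 * (t 1 (u + v) * t 1 (u - v)) + t 0 (u + v) * t 2 (u - v))
      has_field_derivative t 3 (u + v) * t 0 (u - v) + t 2 (u + v) * t 1 (u - v)
        - t 1 (u + v) * t 2 (u - v) - t 0 (u + v) * t 3 (u - v)) (at v)"
    using DERIV_add[OF DERIV_add[OF DERIV_t_times_t(2)[of 2 u 0 v]
          DERIV_cmult[OF DERIV_t_times_t(2)[of 1 u 1 v], of 2]] DERIV_t_times_t(2)[of 0 u 2 v]]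
    by (simp add: eval_nat_numeral algebra_simps)
  show "((\<lambda>v. t 2 (u + v) * t 0 (u - v) + 2 * (t 1 (u + v) * t 1 (u - v)) + t 0 (u + v) * t 2 (u - v))
      has_field_derivative A 2 u * B 1 v - B 2 u * A 1 v) (at v)"
    unfolding cross_20
    by (rule derivative_eq_intros DERIV_A DERIV_B refl | simp)+
qed

text \<open>
  On the diagonal \<open>u = v\<close> the second factor of each product is evaluated at \<open>0\<close>, where the even derivatives
  of \<open>t\<close> vanish.
\<close>

lemma wronskians:
  "t 1 0 * t 0 (2 * y) = A 1 y * B 0 y - B 1 y * A 0 y"
  "2 * t 1 0 * t 1 (2 * y) = A 2 y * B 0 y - B 2 y * A 0 y"
  "t 3 0 * t 0 (2 * y) - t 1 0 * t 2 (2 * y) = B 2 y * A 1 y - A 2 y * B 1 y"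
  using cross_10[of y y] cross_20[of y y] cross_21[of y y] t_even_at_0[of 0] t_even_at_0[of 2]
  by (simp_all add: algebra_simps)

text \<open>
  Write \<open>p\<close>, \<open>p'\<close> for the vector \<open>(A, B)\<close> and its derivative at the first point.  Three vectors \<open>p\<close>, \<open>p'\<close>, \<open>q\<close> in the
  plane are linearly dependent, with cross products as coefficients; the inner product of this dependency with a
  fourth vector \<open>r\<close> is the relation below.  After division by the theta factors on the right it says that a
  signed sum of four values of \<open>s' / s\<close> and \<open>t' / t\<close> is a quotient of theta products.
\<close>

lemma s_zeta_addition:
  "t 1 0 * t 0 (2 * y) * (s 0 (u + v) * s 0 (u - v)) =
     s 0 (y + v) * s 0 (y - v) * (t 1 (y + u) * t 0 (y - u) + t 0 (y + u) * t 1 (y - u))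
     - t 0 (y + u) * t 0 (y - u) * (s 1 (y + v) * s 0 (y - v) + s 0 (y + v) * s 1 (y - v))"
  unfolding wronskians s_times_s t_times_t dot_10 cross_10 by algebra

text \<open>
  The Binet--Cauchy identity \<open>(p' \<times> p) (q \<times> r) = (p' \<bullet> q) (p \<bullet> r) - (p' \<bullet> r) (p \<bullet> q)\<close>.
\<close>

lemma s_zeta_addition':
  "t 1 0 * t 0 (2 * u) * (t 0 (y + v) * t 0 (y - v)) =
     (s 1 (u + y) * s 0 (u - y) + s 0 (u + y) * s 1 (u - y)) * (s 0 (u + v) * s 0 (u - v))
     - (s 1 (u + v) * s 0 (u - v) + s 0 (u + v) * s 1 (u - v)) * (s 0 (u + y) * s 0 (u - y))"
  unfolding wronskians s_times_s t_times_t dot_10 by algebra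

text \<open>
  The linear dependency of \<open>p\<close>, \<open>p'\<close>, \<open>p''\<close>, paired with a fourth vector by the inner product, and in the next
  lemma by the cross product.  In terms of \<open>\<zeta>\<close>-type functions \<open>Z = f' / f\<close> and \<open>Q = f'' / f\<close> it is the classical
  relation \<open>Q a + Q b + Q c + 2 (Z a Z b + Z b Z c + Z c Z a) = t 3 0 / t 1 0\<close> for \<open>a + b + c = 0\<close>.
\<close>

lemma s_heat_addition:
  "t 1 0 * t 0 (2 * y) *
      (s 2 (y + v) * s 0 (y - v) + 2 * (s 1 (y + v) * s 1 (y - v)) + s 0 (y + v) * s 2 (y - v))
   = 2 * t 1 0 * t 1 (2 * y) * (s 1 (y + v) * s 0 (y - v) + s 0 (y + v) * s 1 (y - v))
     + (t 3 0 * t 0 (2 * y) - t 1 0 * t 2 (2 * y)) * (s 0 (y + v) * s 0 (y - v))"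
  unfolding wronskians s_times_s dot_10 dot_20 by algebra

lemma t_heat_addition:
  "t 1 0 * t 0 (2 * y) *
      (t 2 (y + v) * t 0 (y - v) + 2 * (t 1 (y + v) * t 1 (y - v)) + t 0 (y + v) * t 2 (y - v))
   = 2 * t 1 0 * t 1 (2 * y) * (t 1 (y + v) * t 0 (y - v) + t 0 (y + v) * t 1 (y - v))
     + (t 3 0 * t 0 (2 * y) - t 1 0 * t 2 (2 * y)) * (t 0 (y + v) * t 0 (y - v))"
  unfolding wronskians t_times_t cross_10 cross_20 by algebra

text \<open>
  Lagrange's identity \<open>|p|\<^sup>2 |p''|\<^sup>2 = (p \<bullet> p'')\<^sup>2 + (p \<times> p'')\<^sup>2\<close> at the origin.
\<close>

lemma s_fourth_derivative_at_0:
  assumes "s 0 0 \<noteq> 0"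
  shows "s 4 0 / s 0 0 = 3 * (s 2 0 / s 0 0)\<^sup>2 + 2 * (t 1 0 / s 0 0) ^ 4"
proof -
  have "(A 0 0 ^ 2 + B 0 0 ^ 2) * (A 2 0 ^ 2 + B 2 0 ^ 2) =
      (A 2 0 * A 0 0 + B 2 0 * B 0 0) ^ 2 + (A 2 0 * B 0 0 - B 2 0 * A 0 0) ^ 2"
    by algebra
  moreover have "A 0 0 ^ 2 + B 0 0 ^ 2 = s 0 0 ^ 2"
    using s_times_s[of 0 0] by (simp add: power2_eq_square)
  moreover have "A 2 0 ^ 2 + B 2 0 ^ 2 = 2 * (s 4 0 * s 0 0 - s 2 0 ^ 2)"
    using dot_22[of 0 0] by (simp add: power2_eq_square algebra_simps)
  moreover have "A 2 0 * A 0 0 + B 2 0 * B 0 0 = 2 * s 2 0 * s 0 0"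
    using dot_20[of 0 0] s_odd_at_0[of 1] by (simp add: mult.commute mult.left_commute)
  moreover have "A 2 0 * B 0 0 - B 2 0 * A 0 0 = 2 * t 1 0 ^ 2"
    using cross_20[of 0 0] t_even_at_0[of 0] by (simp add: power2_eq_square)
  ultimately have "s 0 0 ^ 2 * (2 * (s 4 0 * s 0 0 - s 2 0 ^ 2)) =
      (2 * s 2 0 * s 0 0) ^ 2 + (2 * t 1 0 ^ 2) ^ 2" by simp
  hence "s 4 0 * s 0 0 ^ 3 = 3 * s 2 0 ^ 2 * s 0 0 ^ 2 + 2 * t 1 0 ^ 4" by algebra
  thus ?thesis using assms by (simp add: field_simps power2_eq_square eval_nat_numeral)
qed

end

locale theta_pair_thirds = theta_pair +
  assumes nonzero: "s 0 0 \<noteq> 0" "s 0 (1/3) \<noteq> 0" "t 0 (1/3) \<noteq> 0" "t 1 0 \<noteq> 0"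
begin

text \<open>
  In both of the following lemmas the points are chosen such that the four arguments of the addition theorem
  reduce, modulo periods and parity, to \<open>0\<close> and \<open>1/3\<close>.
\<close>

lemma t_prime_s_third:
  defines "\<alpha> \<equiv> s 1 (1/3) / s 0 (1/3)" and "\<beta> \<equiv> t 1 (1/3) / t 0 (1/3)"
  shows "(\<alpha> + 2 * \<beta>) * (t 0 (1/3) * s 0 0) = t 1 0 * s 0 (1/3)"
proof -
  have "t 1 0 * t 0 (1/3) * (s 0 (2/3) * s 0 (1/3)) =
      s 0 (1/3) * s 0 0 * (t 1 (2/3) * t 0 (-1/3) + t 0 (2/3) * t 1 (-1/3))
      - t 0 (2/3) * t 0 (-1/3) * (s 1 (1/3) * s 0 0 + s 0 (1/3) * s 1 0)"
    using s_zeta_addition[of "1/6" "1/2" "1/6"] by simp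
  thus ?thesis
    using nonzero t_minus[of 0 "1/3"] t_minus[of 1 "1/3"]
    by (simp add: s_two_thirds t_two_thirds s_odd_at_0 \<alpha>_def \<beta>_def field_simps)
qed

lemma t_prime_t_third:
  defines "\<alpha> \<equiv> s 1 (1/3) / s 0 (1/3)"
  shows "3 * \<alpha> * (s 0 (1/3) ^ 3 * s 0 0) = - (t 1 0 * t 0 (1/3) ^ 3)"
proof -
  have "t 1 0 * t 0 (2/3) * (t 0 (1/3) * t 0 (-1/3)) =
      (s 1 (1/3) * s 0 (1/3) + s 0 (1/3) * s 1 (1/3)) * (s 0 (2/3) * s 0 0)
      - (s 1 (2/3) * s 0 0 + s 0 (2/3) * s 1 0) * (s 0 (1/3) * s 0 (1/3))"
    using s_zeta_addition'[of "1/3" 0 "1/3"] by simp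
  thus ?thesis
    using nonzero t_minus[of 0 "1/3"]
    by (simp add: s_two_thirds t_two_thirds s_odd_at_0 \<alpha>_def field_simps eval_nat_numeral)
qed

text \<open>
  The heat relation for the triples \<open>(0, 1/3, -1/3)\<close> and \<open>(1/3, 1/3, -2/3)\<close>, in the second case once with
  one and once with three values of \<open>t\<close>, gives three linear equations for the three unknown ratios.
\<close>

lemma heat_ratios:
  defines "\<alpha> \<equiv> s 1 (1/3) / s 0 (1/3)" and "\<beta> \<equiv> t 1 (1/3) / t 0 (1/3)"
  defines "X \<equiv> s 2 0 / s 0 0"
  shows "s 2 (1/3) / s 0 (1/3) = X - 2 * \<alpha>\<^sup>2 - 6 * \<alpha> * \<beta>"
    and "t 2 (1/3) / t 0 (1/3) = X - \<alpha>\<^sup>2 - 4 * \<alpha> * \<beta> - 3 * \<beta>\<^sup>2"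
    and "t 3 0 / t 1 0 = 3 * X - 3 * \<alpha>\<^sup>2 - 12 * \<alpha> * \<beta> - 3 * \<beta>\<^sup>2"
proof -
  define S T J where "S = s 2 (1/3) / s 0 (1/3)" and "T = t 2 (1/3) / t 0 (1/3)"
    and "J = t 3 0 / t 1 0"
  have eqs: "s 1 (1/3) = \<alpha> * s 0 (1/3)" "t 1 (1/3) = \<beta> * t 0 (1/3)"
    "s 2 (1/3) = S * s 0 (1/3)" "t 2 (1/3) = T * t 0 (1/3)" "s 2 0 = X * s 0 0" "t 3 0 = J * t 1 0"
    using nonzero by (simp_all add: \<alpha>_def \<beta>_def S_def T_def J_def X_def)
  have "t 1 0 * t 0 (1/3) * (s 2 (1/3) * s 0 0 + s 0 (1/3) * s 2 0) =
      2 * t 1 0 * t 1 (1/3) * (s 1 (1/3) * s 0 0)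
      + (t 3 0 * t 0 (1/3) - t 1 0 * t 2 (1/3)) * (s 0 (1/3) * s 0 0)"
    using s_heat_addition[of "1/6" "1/6"] by (simp add: s_odd_at_0)
  hence "(t 1 0 * t 0 (1/3) * s 0 (1/3) * s 0 0) * (S + X + T - 2 * \<alpha> * \<beta> - J) = 0"
    unfolding eqs by algebra
  hence 1: "S + X + T - 2 * \<alpha> * \<beta> - J = 0"
    using nonzero by simp
  have "t 1 0 * t 0 (2/3) * (2 * (s 2 (1/3) * s 0 (1/3)) + 2 * (s 1 (1/3) * s 1 (1/3))) =
      2 * t 1 0 * t 1 (2/3) * (2 * (s 1 (1/3) * s 0 (1/3)))
      + (t 3 0 * t 0 (2/3) - t 1 0 * t 2 (2/3)) * (s 0 (1/3) * s 0 (1/3))"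
    using s_heat_addition[of "1/3" 0] by (simp add: algebra_simps)
  hence "(t 1 0 * t 0 (1/3) * s 0 (1/3) * s 0 (1/3)) *
      (2 * S + 2 * \<alpha>\<^sup>2 + 4 * \<alpha> * \<beta> + T - J) = 0"
    unfolding t_two_thirds eqs by simp algebra
  hence 2: "2 * S + 2 * \<alpha>\<^sup>2 + 4 * \<alpha> * \<beta> + T - J = 0"
    using nonzero by simp
  have "t 1 0 * t 0 (2/3) * (2 * (t 2 (1/3) * t 0 (1/3)) + 2 * (t 1 (1/3) * t 1 (1/3))) =
      2 * t 1 0 * t 1 (2/3) * (2 * (t 1 (1/3) * t 0 (1/3)))
      + (t 3 0 * t 0 (2/3) - t 1 0 * t 2 (2/3)) * (t 0 (1/3) * t 0 (1/3))"
    using t_heat_addition[of "1/3" 0] by (simp add: algebra_simps)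
  hence "(t 1 0 * t 0 (1/3) * t 0 (1/3) * t 0 (1/3)) * (3 * T + 6 * \<beta>\<^sup>2 - J) = 0"
    unfolding t_two_thirds eqs by simp algebra
  hence 3: "3 * T + 6 * \<beta>\<^sup>2 - J = 0"
    using nonzero by simp
  show S: "s 2 (1/3) / s 0 (1/3) = X - 2 * \<alpha>\<^sup>2 - 6 * \<alpha> * \<beta>"
    using 1 2 unfolding S_def[symmetric] by algebra
  show T: "t 2 (1/3) / t 0 (1/3) = X - \<alpha>\<^sup>2 - 4 * \<alpha> * \<beta> - 3 * \<beta>\<^sup>2"
    using 1 2 3 unfolding T_def[symmetric] by algebra
  show "t 3 0 / t 1 0 = 3 * X - 3 * \<alpha>\<^sup>2 - 12 * \<alpha> * \<beta> - 3 * \<beta>\<^sup>2"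
    using 1 2 3 unfolding J_def[symmetric] by algebra
qed

end

section \<open>The Jacobi triple product\<close>

lemma convergent_prod_geometric:
  fixes f :: "nat \<Rightarrow> complex"
  assumes "\<bar>r\<bar> < 1" "\<And>n. norm (f n - 1) \<le> C * r ^ n"
  shows "convergent_prod f"
proof -
  have "summable (\<lambda>n. C * r ^ n)"
    using assms(1) by (intro summable_mult summable_geometric) simp
  hence "summable (\<lambda>n. norm (f n - 1))"
    by (rule summable_comparison_test') (use assms(2) in auto)
  thus ?thesis
    by (intro abs_convergent_prod_imp_convergent_prod) (simp add: abs_convergent_prod_conv_summable)
qed

lemma prodinf_LIMSEQ_lessThan:
  fixes f :: "nat \<Rightarrow> complex"
  assumes "convergent_prod f"
  shows "(\<lambda>n. \<Prod>k<n. f k) \<longlonglongrightarrow> prodinf f"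
  using convergent_prod_LIMSEQ[OF assms] by (simp add: LIMSEQ_lessThan_iff_atMost)

definition euler :: "complex \<Rightarrow> complex" where
  "euler q = (\<Prod>n. 1 - q ^ Suc n)"

lemma power_Suc_neq_1:
  fixes q :: complex
  assumes "norm q < 1"
  shows "q ^ Suc n \<noteq> 1"
proof
  assume "q ^ Suc n = 1"
  hence "norm q ^ Suc n = 1" by (metis norm_one norm_power)
  thus False using assms power_less_one_iff[of "norm q" "Suc n"] by simp
qed

context
  fixes q :: complex
  assumes q: "norm q < 1"
begin

lemma convergent_prod_euler: "convergent_prod (\<lambda>n. 1 - q ^ Suc n)"
  by (rule convergent_prod_geometric[of "norm q" _ "norm q"]) (use q in \<open>auto simp: norm_mult norm_power\<close>)

lemma euler_nonzero: "euler q \<noteq> 0"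
  unfolding euler_def
  by (intro prodinf_nonzero convergent_prod_euler) (metis power_Suc_neq_1[OF q] eq_iff_diff_eq_0)

end

definition qpoch :: "complex \<Rightarrow> nat \<Rightarrow> complex" where
  "qpoch q n = (\<Prod>k<n. 1 - q ^ Suc k)"

text \<open>
  The reciprocal of \<open>(1 - q) ... (1 - q ^ i)\<close>, continued by \<open>0\<close> to negative \<open>i\<close>.  This is the continuation for
  which the recurrence in \<open>recip_qpoch_pred\<close> holds for all integers, so that the induction for the finite triple
  product has no boundary cases.
\<close>

definition recip_qpoch :: "complex \<Rightarrow> int \<Rightarrow> complex" where
  "recip_qpoch q i = (if i < 0 then 0 else 1 / qpoch q (nat i))"

context
  fixes q :: complex
  assumes q: "norm q < 1" "q \<noteq> 0"
begin

lemma qpoch_LIMSEQ: "qpoch q \<longlonglongrightarrow> euler q"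
  using prodinf_LIMSEQ_lessThan[OF convergent_prod_euler[OF q(1)]]
  unfolding qpoch_def euler_def by simp

lemma recip_qpoch_pred: "recip_qpoch q (i - 1) = (1 - q powi i) * recip_qpoch q i"
proof (cases "i > 0")
  case True
  then obtain n where i: "i = int (Suc n)" by (metis gr0_implies_Suc zero_less_imp_eq_int)
  have "recip_qpoch q (i - 1) = 1 / qpoch q n" by (simp add: recip_qpoch_def i)
  moreover have "recip_qpoch q i = 1 / (qpoch q n * (1 - q ^ Suc n))"
    by (simp add: recip_qpoch_def i qpoch_def nat_add_distrib)
  moreover have "q powi i = q ^ Suc n" by (simp only: i power_int_of_nat)
  moreover have "1 - q ^ Suc n \<noteq> 0" using power_Suc_neq_1[OF q(1), of n] by simp
  ultimately show ?thesis by (simp del: power_Suc)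
next
  case False
  thus ?thesis by (cases "i = 0") (simp_all add: recip_qpoch_def)
qed

lemma recip_qpoch_LIMSEQ: "(\<lambda>N. recip_qpoch q (int N + j)) \<longlonglongrightarrow> 1 / euler q"
proof -
  have "filterlim (\<lambda>N. nat (int N + j)) sequentially sequentially"
    unfolding filterlim_at_top
  proof
    fix Z
    show "\<forall>\<^sub>F N in sequentially. Z \<le> nat (int N + j)"
      by (rule eventually_sequentiallyI[of "nat (int Z - j)"]) linarith
  qed
  hence "(\<lambda>N. 1 / qpoch q (nat (int N + j))) \<longlonglongrightarrow> 1 / euler q"
    by (intro tendsto_intros filterlim_compose[OF qpoch_LIMSEQ] euler_nonzero q)
  moreover have "\<forall>\<^sub>F N in sequentially. 1 / qpoch q (nat (int N + j)) = recip_qpoch q (int N + j)"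
    by (rule eventually_sequentiallyI[of "nat (- j)"]) (auto simp: recip_qpoch_def)
  ultimately show ?thesis by (rule Lim_transform_eventually)
qed

lemma bounded_recip_qpoch: obtains K where "\<And>i. norm (recip_qpoch q i) \<le> K" "K \<ge> 0"
proof -
  have "Bseq (\<lambda>N. recip_qpoch q (int N + 0))"
    by (intro convergent_imp_Bseq convergentI) (rule recip_qpoch_LIMSEQ)
  then obtain K where K: "K > 0" "\<And>N. norm (recip_qpoch q (int N)) \<le> K"
    by (auto simp: Bseq_def)
  have "norm (recip_qpoch q i) \<le> K" for i
    using K(1) K(2)[of "nat i"] by (cases "i < 0") (auto simp: recip_qpoch_def)
  thus ?thesis using that K(1) by force
qed

end

text \<open>
  The coefficient of \<open>\<zeta> powi j\<close> in the finite triple product with \<open>N\<close> factors: the Gaussian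
  binomial coefficient of \<open>2 N\<close> over \<open>N + j\<close>, in base \<open>x\<^sup>2\<close>, times \<open>x powi j\<^sup>2\<close>.
\<close>

definition jtp_coeff :: "complex \<Rightarrow> nat \<Rightarrow> int \<Rightarrow> complex" where
  "jtp_coeff x N j =
     qpoch (x\<^sup>2) (2 * N) * recip_qpoch (x\<^sup>2) (N + j) * recip_qpoch (x\<^sup>2) (N - j) * x powi (j\<^sup>2)"

context
  fixes x :: complex
  assumes x: "norm x < 1" "x \<noteq> 0"
begin

lemma norm_square_less_1: "norm (x\<^sup>2) < 1" "x\<^sup>2 \<noteq> 0"
  using x by (auto simp: norm_power power_less_one_iff)

text \<open>
  All neighbouring coefficients are multiples of the same product of two reciprocals, so that the recurrence
  is an identity between rational functions of \<open>Q = x ^ (2 N + 2)\<close>, \<open>J = x powi (2 j)\<close> and \<open>x\<close>.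
\<close>

lemma jtp_coeff_Suc:
  "jtp_coeff x (Suc N) j = (1 + x ^ (4 * N + 2)) * jtp_coeff x N j
     + x ^ (2 * N + 1) * (jtp_coeff x N (j - 1) + jtp_coeff x N (j + 1))"
proof -
  define q Q J where "q = x\<^sup>2" and "Q = q ^ (N + 1)" and "J = q powi j"
  define r s y where "r = recip_qpoch q (N + 1 + j)" and "s = recip_qpoch q (N + 1 - j)"
    and "y = x powi (j\<^sup>2)"
  have nz: "q \<noteq> 0" "Q \<noteq> 0" "J \<noteq> 0" "x \<noteq> 0" using x by (auto simp: q_def Q_def J_def)
  note pred = recip_qpoch_pred[OF norm_square_less_1, folded q_def]
  have r1: "recip_qpoch q (N + j) = (1 - Q * J) * r"
    using pred[of "N + 1 + j"] nz by (simp add: r_def Q_def J_def power_int_add algebra_simps)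
  have s1: "recip_qpoch q (N - j) = (1 - Q / J) * s"
    using pred[of "N + 1 - j"] nz by (simp add: s_def Q_def J_def power_int_diff power_int_add algebra_simps)
  have r2: "recip_qpoch q (N + (j - 1)) = (1 - Q * J / q) * (1 - Q * J) * r"
  proof -
    have "q powi (N + j) = Q * J / q" using nz by (simp add: Q_def J_def power_int_add)
    thus ?thesis using pred[of "N + j"] r1 by (simp add: add_diff_eq)
  qed
  have s2: "recip_qpoch q (N - (j + 1)) = (1 - Q / (J * q)) * (1 - Q / J) * s"
  proof -
    have "q powi (N - j) = Q / (J * q)" using nz by (simp add: Q_def J_def power_int_diff)
    thus ?thesis using pred[of "N - j"] s1 by (simp add: diff_diff_eq)
  qed
  have rs: "recip_qpoch q (N + (j + 1)) = r" "recip_qpoch q (N - (j - 1)) = s"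
    "recip_qpoch q (Suc N + j) = r" "recip_qpoch q (Suc N - j) = s"
    by (simp_all add: r_def s_def algebra_simps)
  have J: "J = x powi (2 * j)" by (simp add: J_def q_def power_int_mult)
  have y: "x powi ((j - 1)\<^sup>2) = y * x / J" "x powi ((j + 1)\<^sup>2) = y * x * J"
    using nz by (simp_all add: y_def J power2_eq_square algebra_simps power_int_add power_int_diff)
  have "q powi N = Q / q" using nz by (simp add: Q_def)
  have P: "qpoch q (2 * Suc N) = qpoch q (2 * N) * ((1 - Q\<^sup>2 / q) * (1 - Q\<^sup>2))"
  proof -
    have "q ^ (2 * N) = q ^ N * q ^ N" by (simp add: mult_2 power_add)
    hence "q ^ Suc (2 * N) = Q\<^sup>2 / q" "q ^ Suc (Suc (2 * N)) = Q\<^sup>2"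
      using nz by (simp_all add: Q_def power2_eq_square)
    moreover have "qpoch q (Suc (Suc m)) = qpoch q m * ((1 - q ^ Suc m) * (1 - q ^ Suc (Suc m)))" for m
      by (simp add: qpoch_def)
    ultimately show ?thesis by (simp only: mult_Suc_right add_2_eq_Suc)
  qed
  have X: "x ^ (4 * N + 2) = Q\<^sup>2 / q" "x ^ (2 * N + 1) = Q / x"
  proof -
    have "Q = x ^ (2 * N + 1) * x"
      by (simp add: Q_def q_def power2_eq_square power_mult_distrib mult_2 power_add)
    moreover have "x ^ (4 * N + 2) = x ^ (2 * N + 1) * x ^ (2 * N + 1)"
      by (simp flip: power_add)
    ultimately show "x ^ (4 * N + 2) = Q\<^sup>2 / q" "x ^ (2 * N + 1) = Q / x"
      using nz by (simp_all add: q_def power2_eq_square power_mult_distrib)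
  qed
  show ?thesis
    unfolding jtp_coeff_def q_def[symmetric] P X r1 r2 s1 s2 rs y y_def[symmetric]
    using nz by (simp add: field_simps power2_eq_square)
qed

text \<open>
  With \<open>p = x ^ (2 N + 1)\<close> the new factor is \<open>(1 + p \<zeta>) (1 + p / \<zeta>) = (1 + p\<^sup>2) + p (\<zeta> + 1 / \<zeta>)\<close>, and multiplication by
  \<open>\<zeta>\<close> or \<open>1 / \<zeta>\<close> shifts the coefficients.
\<close>

lemma finite_jacobi_triple_product:
  assumes "\<zeta> \<noteq> 0"
  shows "((\<lambda>j. jtp_coeff x N j * \<zeta> powi j) has_sum
    (\<Prod>k<N. (1 + x ^ (2 * k + 1) * \<zeta>) * (1 + x ^ (2 * k + 1) / \<zeta>))) UNIV"
proof (induction N)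
  case 0
  show ?case
    by (rule has_sum_finite_neutralI[of "{0}"])
       (auto simp: jtp_coeff_def qpoch_def recip_qpoch_def)
next
  case (Suc N)
  let ?c = "jtp_coeff x N" and ?P = "\<Prod>k<N. (1 + x ^ (2 * k + 1) * \<zeta>) * (1 + x ^ (2 * k + 1) / \<zeta>)"
  have up: "((\<lambda>j. ?c (j - 1) * \<zeta> powi j) has_sum (\<zeta> * ?P)) UNIV"
  proof -
    have "((\<lambda>j. \<zeta> * (?c j * \<zeta> powi j)) has_sum (\<zeta> * ?P)) UNIV"
      by (rule has_sum_cmult_right[OF Suc])
    thus ?thesis
      by (rule iffD1[OF has_sum_reindex_bij_witness[where j = "\<lambda>j. j + 1" and i = "\<lambda>j. j - 1"], rotated -1])
         (use assms in \<open>auto simp: power_int_add\<close>)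
  qed
  have down: "((\<lambda>j. ?c (j + 1) * \<zeta> powi j) has_sum (?P / \<zeta>)) UNIV"
  proof -
    have "((\<lambda>j. 1 / \<zeta> * (?c j * \<zeta> powi j)) has_sum (1 / \<zeta> * ?P)) UNIV"
      by (rule has_sum_cmult_right[OF Suc])
    thus ?thesis
      by (rule iffD1[OF has_sum_reindex_bij_witness[where j = "\<lambda>j. j - 1" and i = "\<lambda>j. j + 1"], rotated -1])
         (use assms in \<open>auto simp: power_int_diff\<close>)
  qed
  have "((\<lambda>j. (1 + x ^ (4 * N + 2)) * (?c j * \<zeta> powi j)
      + x ^ (2 * N + 1) * (?c (j - 1) * \<zeta> powi j + ?c (j + 1) * \<zeta> powi j)) has_sum
      ((1 + x ^ (4 * N + 2)) * ?P + x ^ (2 * N + 1) * (\<zeta> * ?P + ?P / \<zeta>))) UNIV"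
    by (intro has_sum_add has_sum_cmult_right up down Suc)
  moreover have "(1 + x ^ (4 * N + 2)) * ?P + x ^ (2 * N + 1) * (\<zeta> * ?P + ?P / \<zeta>) =
      ?P * ((1 + x ^ (2 * N + 1) * \<zeta>) * (1 + x ^ (2 * N + 1) / \<zeta>))"
  proof -
    have "x ^ (4 * N + 2) = x ^ (2 * N + 1) * x ^ (2 * N + 1)"
      by (simp flip: power_add)
    moreover have "(1 + p * p) * P + p * (\<zeta> * P + P / \<zeta>) = P * ((1 + p * \<zeta>) * (1 + p / \<zeta>))" for p P
      using assms by (simp add: field_simps)
    ultimately show ?thesis by (simp only:)
  qed
  ultimately have sum: "((\<lambda>j. (1 + x ^ (4 * N + 2)) * (?c j * \<zeta> powi j)
      + x ^ (2 * N + 1) * (?c (j - 1) * \<zeta> powi j + ?c (j + 1) * \<zeta> powi j)) has_sum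
      (?P * ((1 + x ^ (2 * N + 1) * \<zeta>) * (1 + x ^ (2 * N + 1) / \<zeta>)))) UNIV"
    by (simp only:)
  show ?case
    unfolding prod.lessThan_Suc
    by (rule iffD1[OF has_sum_cong sum], unfold jtp_coeff_Suc) algebra
qed

end

text \<open>
  As \<open>N\<close> tends to infinity, the \<open>j\<close>-th coefficient of the finite product tends to
  \<open>x powi j\<^sup>2 / euler (x\<^sup>2)\<close>, and it is dominated by a constant multiple of \<open>x powi j\<^sup>2\<close>.  Hence Tannery's theorem permits
  passing to the limit term by term.
\<close>

theorem jacobi_triple_product:
  fixes z \<tau> :: complex
  assumes \<tau>: "Im \<tau> > 0"
  defines "x \<equiv> exp (pi * \<i> * \<tau>)" and "\<zeta> \<equiv> exp (2 * pi * \<i> * z)"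
  shows "theta 0 0 z \<tau> =
    euler (x\<^sup>2) * (\<Prod>n. (1 + x ^ (2 * n + 1) * \<zeta>) * (1 + x ^ (2 * n + 1) / \<zeta>))"
proof -
  have x: "norm x < 1" "x \<noteq> 0" and \<zeta>: "\<zeta> \<noteq> 0"
    using \<tau> by (auto simp: x_def \<zeta>_def norm_exp_eq_Re)
  note q = norm_square_less_1[OF x]
  have term_eq: "theta_term 0 0 z \<tau> j = x powi (j\<^sup>2) * \<zeta> powi j" for j
    unfolding theta_term_def x_def \<zeta>_def exp_power_int exp_add[symmetric] by (simp add: mult_ac)
  define a where "a = (\<lambda>m N. jtp_coeff x N (int_decode m) * \<zeta> powi (int_decode m))"
  define b where "b = (\<lambda>m. theta_term 0 0 z \<tau> (int_decode m) / euler (x\<^sup>2))"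
  obtain K where K: "\<And>i. norm (recip_qpoch (x\<^sup>2) i) \<le> K" "K \<ge> 0"
    using bounded_recip_qpoch[OF q] by blast
  obtain K' where K': "\<And>n. norm (qpoch (x\<^sup>2) n) \<le> K'"
    using convergent_imp_Bseq[OF convergentI[OF qpoch_LIMSEQ[OF q]]] by (auto simp: Bseq_def)
  have "K' \<ge> 0" using K'[of 0] norm_ge_zero order_trans by blast
  have lim: "(\<lambda>N. a m N) \<longlonglongrightarrow> b m" for m
  proof -
    have "(\<lambda>N. qpoch (x\<^sup>2) (2 * N)) \<longlonglongrightarrow> euler (x\<^sup>2)"
      by (rule filterlim_compose[OF qpoch_LIMSEQ[OF q]]) (simp add: filterlim_subseq strict_mono_def)
    moreover have "(\<lambda>N. recip_qpoch (x\<^sup>2) (int N - int_decode m)) \<longlonglongrightarrow> 1 / euler (x\<^sup>2)"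
      using recip_qpoch_LIMSEQ[OF q, of "- int_decode m"] by simp
    ultimately have "(\<lambda>N. a m N) \<longlonglongrightarrow> euler (x\<^sup>2) * (1 / euler (x\<^sup>2)) * (1 / euler (x\<^sup>2))
        * x powi ((int_decode m)\<^sup>2) * \<zeta> powi (int_decode m)"
      unfolding a_def jtp_coeff_def
      by (intro tendsto_mult tendsto_const recip_qpoch_LIMSEQ[OF q])
    thus ?thesis
      using euler_nonzero[OF q(1)] by (simp add: b_def term_eq)
  qed
  have bound: "norm (a m N) \<le> K' * K * K * norm (theta_term 0 0 z \<tau> (int_decode m))" for m N
    unfolding a_def jtp_coeff_def term_eq norm_mult mult.assoc[of _ "norm (x powi _)"]
    by (intro mult_right_mono mult_mono K K' mult_nonneg_nonneg \<open>K' \<ge> 0\<close>) auto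
  have "(\<lambda>N. suminf (\<lambda>m. a m N)) \<longlonglongrightarrow> suminf b"
    using tannerys_theorem[of a b sequentially
        "\<lambda>m. K' * K * K * norm (theta_term 0 0 z \<tau> (int_decode m))"]
      lim bound summable_mult[OF summable_theta_term[OF \<tau>]]
    by (auto intro: always_eventually)
  moreover have "suminf b = theta 0 0 z \<tau> / euler (x\<^sup>2)"
    unfolding b_def using sums_unique[OF sums_divide[OF theta_sums[OF \<tau>]]] by simp
  moreover have "suminf (\<lambda>m. a m N) =
      (\<Prod>k<N. (1 + x ^ (2 * k + 1) * \<zeta>) * (1 + x ^ (2 * k + 1) / \<zeta>))" for N
  proof -
    have "((\<lambda>m. a m N) has_sum
        (\<Prod>k<N. (1 + x ^ (2 * k + 1) * \<zeta>) * (1 + x ^ (2 * k + 1) / \<zeta>))) UNIV"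
      unfolding a_def
      using finite_jacobi_triple_product[OF x \<zeta>, of N] has_sum_reindex_bij_betw[OF bij_int_decode,
          of "\<lambda>j. jtp_coeff x N j * \<zeta> powi j"]
      by (simp only:)
    thus ?thesis by (intro sums_unique[symmetric] has_sum_imp_sums)
  qed
  moreover have conv: "convergent_prod (\<lambda>n. (1 + x ^ (2 * n + 1) * \<zeta>) * (1 + x ^ (2 * n + 1) / \<zeta>))"
  proof (intro convergent_prod_mult)
    have le: "norm x ^ (2 * n + 1) \<le> norm x ^ n" for n
      using x by (intro power_decreasing) auto
    show "convergent_prod (\<lambda>n. 1 + x ^ (2 * n + 1) * \<zeta>)"
      by (rule convergent_prod_geometric[of "norm x" _ "norm \<zeta>"])
         (use x le mult_left_mono[OF le, of "norm \<zeta>"] in \<open>auto simp: norm_mult norm_power mult_ac\<close>)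
    show "convergent_prod (\<lambda>n. 1 + x ^ (2 * n + 1) / \<zeta>)"
      by (rule convergent_prod_geometric[of "norm x" _ "1 / norm \<zeta>"])
         (use x divide_right_mono[OF le, of "norm \<zeta>"] in \<open>auto simp: norm_divide norm_mult norm_power\<close>)
  qed
  ultimately have "(\<lambda>N. \<Prod>k<N. (1 + x ^ (2 * k + 1) * \<zeta>) * (1 + x ^ (2 * k + 1) / \<zeta>))
      \<longlonglongrightarrow> theta 0 0 z \<tau> / euler (x\<^sup>2)"
    by (simp only:)
  hence "theta 0 0 z \<tau> / euler (x\<^sup>2) =
      (\<Prod>n. (1 + x ^ (2 * n + 1) * \<zeta>) * (1 + x ^ (2 * n + 1) / \<zeta>))"
    using prodinf_LIMSEQ_lessThan[OF conv] by (rule LIMSEQ_unique)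
  thus ?thesis
    using euler_nonzero[OF q(1)] by (simp add: field_simps)
qed

section \<open>Theta values as eta quotients\<close>

text \<open>
  The triple product is a product over odd powers of \<open>x\<close>, whereas the eta function is one over all powers;
  lemma \<open>odd_prod_eq_euler\<close> translates between the two.
\<close>

definition odd_prod :: "complex \<Rightarrow> complex" where
  "odd_prod y = (\<Prod>n. 1 + y ^ (2 * n + 1))"

lemma norm_power_odd_le:
  fixes y :: complex
  assumes "norm y < 1"
  shows "norm (y ^ (2 * n + 1)) \<le> norm y ^ n"
  unfolding norm_power using assms by (intro power_decreasing) auto

lemma convergent_prod_odd_prod:
  fixes y :: complex
  assumes "norm y < 1"
  shows "convergent_prod (\<lambda>n. 1 + y ^ (2 * n + 1))"
  by (rule convergent_prod_geometric[of "norm y" _ 1]) (use assms norm_power_odd_le[OF assms] in auto)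

lemma minus_power_odd:
  fixes y :: complex
  shows "(- y) ^ (2 * n + 1) = - (y ^ (2 * n + 1))"
  by (rule power_minus_odd) simp

lemma euler_eq_odd_prod:
  assumes y: "norm y < 1"
  shows "euler y = odd_prod (- y) * euler (y\<^sup>2)"
proof -
  have y2: "norm (y\<^sup>2) < 1" using y by (simp add: norm_power power_less_one_iff)
  have "(\<lambda>N. (\<Prod>k<N. 1 + (- y) ^ (2 * k + 1)) * (\<Prod>k<N. 1 - (y\<^sup>2) ^ Suc k))
      \<longlonglongrightarrow> odd_prod (- y) * euler (y\<^sup>2)"
    unfolding odd_prod_def euler_def
    by (intro tendsto_mult prodinf_LIMSEQ_lessThan convergent_prod_euler y2 convergent_prod_odd_prod)
       (use y in simp)
  moreover have "(\<Prod>k<N. 1 + (- y) ^ (2 * k + 1)) * (\<Prod>k<N. 1 - (y\<^sup>2) ^ Suc k) =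
      (\<Prod>k<2 * N. 1 - y ^ Suc k)" for N
    unfolding minus_power_odd power_mult[symmetric]
    by (induction N) (simp_all add: mult_ac)
  moreover have "(\<lambda>N. \<Prod>k<2 * N. 1 - y ^ Suc k) \<longlonglongrightarrow> euler y"
    unfolding euler_def
    by (rule filterlim_compose[OF prodinf_LIMSEQ_lessThan[OF convergent_prod_euler[OF y]]])
       (simp add: filterlim_subseq strict_mono_def)
  ultimately show ?thesis using LIMSEQ_unique by simp
qed

lemma odd_prod_eq_euler:
  assumes y: "norm y < 1"
  shows "odd_prod y * euler y * euler (y ^ 4) = euler (y\<^sup>2) ^ 2"
proof -
  have y2: "norm (y\<^sup>2) < 1" using y by (simp add: norm_power power_less_one_iff)
  have 1: "odd_prod y * odd_prod (- y) = odd_prod (- (y\<^sup>2))"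
  proof -
    have "(1 + y ^ (2 * n + 1)) * (1 + (- y) ^ (2 * n + 1)) = 1 + (- (y\<^sup>2)) ^ (2 * n + 1)" for n
    proof -
      have "(y\<^sup>2) ^ (2 * n + 1) = y ^ (2 * n + 1) * y ^ (2 * n + 1)"
        unfolding power2_eq_square by (rule power_mult_distrib)
      moreover have "(1 + a) * (1 + - a) = 1 + - (a * a)" for a :: complex
        by (simp add: algebra_simps)
      ultimately show ?thesis unfolding minus_power_odd by (simp only:)
    qed
    moreover have "norm (- y) < 1" using y by simp
    ultimately show ?thesis
      unfolding odd_prod_def
      using prodinf_mult[OF convergent_prod_odd_prod[OF y] convergent_prod_odd_prod[of "- y"]]
      by (simp only:)
  qed
  have 2: "euler y = odd_prod (- y) * euler (y\<^sup>2)"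
    by (rule euler_eq_odd_prod[OF y])
  have 3: "odd_prod (- (y\<^sup>2)) * euler (y ^ 4) = euler (y\<^sup>2)"
    using euler_eq_odd_prod[OF y2] by (simp flip: power_mult)
  have "odd_prod y * euler y * euler (y ^ 4) =
      (odd_prod y * odd_prod (- y)) * euler (y ^ 4) * euler (y\<^sup>2)"
    unfolding 2 by (simp only: mult_ac)
  thus ?thesis
    unfolding 1 3 by (simp only: power2_eq_square)
qed

text \<open>
  At \<open>z = 1/3\<close> the variable \<open>\<zeta>\<close> of the triple product is a primitive cube root of unity, so that each pair
  of conjugate factors is a quotient such as \<open>(1 - a ^ 3) / (1 - a)\<close>.
\<close>

lemma omega_sum: "exp (2 * pi * \<i> * (1/3)) + 1 / exp (2 * pi * \<i> * (1/3)) = -1"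
proof -
  have e: "exp (2 * pi * \<i> * (1/3)) = cis (2 * pi / 3)"
    unfolding cis_conv_exp by (rule arg_cong[where f = exp]) simp
  have "1 / cis (2 * pi / 3) = cis (- (2 * pi / 3))"
    unfolding cis_inverse[symmetric] by (rule inverse_eq_divide[symmetric])
  thus ?thesis
    unfolding e by (simp add: complex_eq_iff cos_120)
qed

lemma omega_times:
  fixes a :: complex
  defines "\<omega> \<equiv> exp (2 * pi * \<i> * (1/3))"
  shows "(1 + a * \<omega>) * (1 + a / \<omega>) = 1 - a + a\<^sup>2"
    and "(1 - a * \<omega>) * (1 - a / \<omega>) = 1 + a + a\<^sup>2"
proof -
  have "\<omega> \<noteq> 0" by (simp add: \<omega>_def)
  hence "(1 + b * \<omega>) * (1 + b / \<omega>) = 1 + b * (\<omega> + 1 / \<omega>) + b\<^sup>2" for b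
    by (simp add: field_simps power2_eq_square)
  hence *: "(1 + b * \<omega>) * (1 + b / \<omega>) = 1 - b + b\<^sup>2" for b
    unfolding \<omega>_def omega_sum by simp
  show "(1 + a * \<omega>) * (1 + a / \<omega>) = 1 - a + a\<^sup>2" by (rule *)
  show "(1 - a * \<omega>) * (1 - a / \<omega>) = 1 + a + a\<^sup>2" using *[of "- a"] by simp
qed

definition qprod :: "complex \<Rightarrow> complex \<Rightarrow> complex" where
  "qprod q w = (\<Prod>n. 1 - q ^ Suc n * w)"

context
  fixes q :: complex
  assumes q: "norm q < 1"
begin

lemma norm_qprod_factor: "norm (1 - q ^ Suc n * w - 1) = norm q ^ Suc n * norm w"
proof -
  have "1 - q ^ Suc n * w - 1 = - (q ^ Suc n * w)" by algebra
  thus ?thesis by (simp only: norm_minus_cancel norm_mult norm_power)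
qed

lemma convergent_prod_qprod: "convergent_prod (\<lambda>n. 1 - q ^ Suc n * w)"
proof (rule convergent_prod_geometric)
  show "norm (1 - q ^ Suc n * w - 1) \<le> norm q * norm w * norm q ^ n" for n
    unfolding norm_qprod_factor by simp
qed (use q in simp)

text \<open>
  Continuity is what is needed to read off the derivative of the odd theta function at \<open>0\<close>, where the factor
  \<open>sin (\<pi> z)\<close> of its product vanishes.
\<close>

lemma isCont_qprod: "isCont (qprod q) 1"
proof -
  have "uniformly_convergent_on (cball 0 2) (\<lambda>N w. \<Prod>n<N. 1 - q ^ Suc n * w)"
  proof (rule uniformly_convergent_on_prod')
    show "uniformly_convergent_on (cball 0 2) (\<lambda>N w. \<Sum>n<N. norm (1 - q ^ Suc n * w - 1))"
    proof (rule Weierstrass_m_test'[where M = "\<lambda>n. 2 * norm q ^ Suc n"])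
      show "norm (norm (1 - q ^ Suc n * w - 1)) \<le> 2 * norm q ^ Suc n" if "w \<in> cball 0 2" for n w
      proof -
        have "norm q ^ Suc n * norm w \<le> norm q ^ Suc n * 2"
          using that by (intro mult_left_mono) auto
        thus ?thesis
          unfolding norm_qprod_factor real_norm_def by (simp only: abs_norm_cancel abs_mult mult.commute)
            simp
      qed
      show "summable (\<lambda>n. 2 * norm q ^ Suc n)"
        using q by (intro summable_mult summable_Suc_iff[THEN iffD2] summable_geometric) simp
    qed
  qed (auto intro!: continuous_intros)
  then obtain l where l: "uniform_limit (cball 0 2) (\<lambda>N w. \<Prod>n<N. 1 - q ^ Suc n * w) l sequentially"
    by (auto simp: uniformly_convergent_on_def)
  have "continuous_on (cball 0 2) l"
    by (rule uniform_limit_theorem[OF _ l]) (auto intro!: always_eventually continuous_intros)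
  moreover have "l w = qprod q w" if "w \<in> cball 0 2" for w
    using LIMSEQ_unique[OF tendsto_uniform_limitI[OF l that]
        prodinf_LIMSEQ_lessThan[OF convergent_prod_qprod]] by (simp add: qprod_def)
  ultimately have "continuous_on (cball 0 2) (qprod q)"
    by (rule continuous_on_eq)
  thus ?thesis
    by (rule continuous_on_interior) (simp add: interior_cball)
qed

end

text \<open>
  In the next two lemmas \<open>h\<close> stands for \<open>exp (\<pi> \<i> \<tau> / 24)\<close>, \<open>e1, e2, ...\<close> for the Euler products of the powers of \<open>x\<close>,
  \<open>s\<close> for the square root of \<open>3\<close> and \<open>p\<close> for \<open>\<pi>\<close>.
\<close>

lemma eta_quotient_u:
  fixes h e1 e2 e3 e4 e6 e12 s :: complex
  assumes nz: "h \<noteq> 0" "e1 \<noteq> 0" "e2 \<noteq> 0" "e3 \<noteq> 0" "e4 \<noteq> 0" "e6 \<noteq> 0" "e12 \<noteq> 0"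
   and s: "s ^ 4 = 9"
  shows "((h ^ 2 * e2) ^ 4 * (h ^ 3 * e3) ^ 4 * (h ^ 12 * e12) ^ 4) /
     ((h * e1) ^ 4 * (h ^ 4 * e4) ^ 4 * (h ^ 6 * e6) ^ 4) =
     (- (s * h ^ 6 * e6) / (e1 * e4 * e6 ^ 2 / (e2 * e3 * e12))) ^ 4 / 9"
proof -
  define R where "R = h ^ 6 * (e2 * e3 * e12) / (e1 * e4 * e6)"
  have "(h ^ 2 * e2) * (h ^ 3 * e3) * (h ^ 12 * e12) / ((h * e1) * (h ^ 4 * e4) * (h ^ 6 * e6)) = R"
    unfolding R_def using nz by (simp add: field_simps eval_nat_numeral)
  moreover have "- (s * h ^ 6 * e6) / (e1 * e4 * e6 ^ 2 / (e2 * e3 * e12)) = - s * R"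
    unfolding R_def using nz by (simp add: field_simps power2_eq_square)
  moreover have "(- s * R) ^ 4 / 9 = R ^ 4" using s by (simp add: power_mult_distrib)
  ultimately show ?thesis
    by (simp only: power_mult_distrib[symmetric] power_divide[symmetric])
qed

lemma eta_quotient_U:
  fixes h e1 e2 e3 e4 e6 e12 s p :: complex
  assumes nz: "h \<noteq> 0" "e1 \<noteq> 0" "e2 \<noteq> 0" "e3 \<noteq> 0" "e4 \<noteq> 0" "e6 \<noteq> 0" "e12 \<noteq> 0" "s \<noteq> 0" "p \<noteq> 0"
  shows "((h * e1) ^ 3 * (h ^ 4 * e4) ^ 3 * (h ^ 6 * e6)) /
     ((h ^ 2 * e2) ^ 3 * (h ^ 3 * e3) * (h ^ 12 * e12)) =
     s / (2 * p) * (- (2 * p * h ^ 6 * e2 ^ 3) * (e1 * e4 * e6 ^ 2 / (e2 * e3 * e12)) /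
       (- (s * h ^ 6 * e6) * (e2 ^ 5 / (e1 * e4) ^ 2)))"
  using nz by (simp add: field_simps eval_nat_numeral)

context
  fixes \<tau> x :: complex
  assumes \<tau>: "Im \<tau> > 0"
  defines "x \<equiv> exp (pi * \<i> * \<tau>)"
begin

lemma x_bounds: "norm x < 1" "x \<noteq> 0"
  using \<tau> by (simp_all add: x_def norm_exp_eq_Re)

lemma norm_power_x: "n > 0 \<Longrightarrow> norm (x ^ n) < 1"
  using x_bounds by (simp add: norm_power power_less_one_iff)

lemma theta3_0: "theta 0 0 0 \<tau> = euler (x\<^sup>2) * odd_prod x ^ 2"
  using jacobi_triple_product[OF \<tau>, of 0]
  unfolding x_def[symmetric] mult_zero_right exp_zero mult_1_right div_by_1
    odd_prod_def power2_eq_square[of "prodinf _"]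
    prodinf_mult[OF convergent_prod_odd_prod convergent_prod_odd_prod, OF x_bounds(1) x_bounds(1)] .

lemma theta3_third: "theta 0 0 (1/3) \<tau> * odd_prod x = euler (x\<^sup>2) * odd_prod (x ^ 3)"
proof -
  have "theta 0 0 (1/3) \<tau> = euler (x\<^sup>2) * (\<Prod>n. 1 - x ^ (2 * n + 1) + (x ^ (2 * n + 1))\<^sup>2)"
    using jacobi_triple_product[OF \<tau>, of "1/3"] unfolding omega_times by (simp add: x_def)
  moreover have "(\<Prod>n. 1 - x ^ (2 * n + 1) + (x ^ (2 * n + 1))\<^sup>2) * odd_prod x = odd_prod (x ^ 3)"
  proof -
    have "convergent_prod (\<lambda>n. 1 - x ^ (2 * n + 1) + (x ^ (2 * n + 1))\<^sup>2)"
    proof (rule convergent_prod_geometric)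
      show "norm (1 - x ^ (2 * n + 1) + (x ^ (2 * n + 1))\<^sup>2 - 1) \<le> 2 * norm x ^ n" for n
      proof -
        have "norm (- (x ^ (2 * n + 1)) + (x ^ (2 * n + 1))\<^sup>2) \<le>
            norm (x ^ (2 * n + 1)) + norm (x ^ (2 * n + 1)) ^ 2"
          by (metis norm_triangle_ineq norm_minus_cancel norm_power)
        also have "\<dots> \<le> norm x ^ n + norm x ^ n * 1"
          unfolding power2_eq_square
          using norm_power_odd_le[OF x_bounds(1), of n] norm_power_x[of "2 * n + 1"]
          by (intro add_mono mult_mono) auto
        finally show ?thesis by simp
      qed
    qed (use x_bounds in auto)
    thus ?thesis
      unfolding odd_prod_def
      by (subst prodinf_mult[OF _ convergent_prod_odd_prod[OF x_bounds(1)]], assumption)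
         (auto intro!: prodinf_cong simp: algebra_simps power2_eq_square power3_eq_cube power_mult
            simp flip: power_mult_distrib)
  qed
  ultimately show ?thesis by simp
qed

text \<open>
  The odd theta function is the even one translated by the half period \<open>(1 + \<tau>) / 2\<close>, up to an exponential
  factor; the translation turns \<open>\<zeta>\<close> into \<open>- x \<zeta>\<close> in the triple product.
\<close>

lemma theta1_product:
  fixes z :: complex
  shows "theta 0 (1/2) (z + 1/2) \<tau> = - 2 * exp (pi * \<i> * \<tau> / 4) * sin (pi * z) *
     (euler (x\<^sup>2) * (qprod (x\<^sup>2) (exp (2 * pi * \<i> * z)) * qprod (x\<^sup>2) (1 / exp (2 * pi * \<i> * z))))"
proof -
  define w \<zeta> where "w = z + 1/2 + \<tau> / 2" and "\<zeta> = exp (2 * pi * \<i> * z)"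
  have q: "norm (x\<^sup>2) < 1" using norm_power_x by simp
  have \<zeta>: "\<zeta> \<noteq> 0" by (simp add: \<zeta>_def)
  have w: "exp (2 * pi * \<i> * w) = - (x * \<zeta>)"
  proof -
    have "exp (2 * pi * \<i> * w) = exp (2 * pi * \<i> * z + \<i> * pi + pi * \<i> * \<tau>)"
      by (simp add: w_def algebra_simps)
    thus ?thesis by (simp add: exp_add x_def \<zeta>_def)
  qed
  have term_eq: "theta_term 0 (1/2) (z + 1/2) \<tau> n =
      exp (pi * \<i> * \<tau> / 4 + pi * \<i> * (z + 1/2)) * theta_term 0 0 w \<tau> n" for n
    unfolding theta_term_def power_0 mult_1_left exp_add[symmetric] w_def
    by (rule arg_cong[where f = exp]) (simp add: power2_eq_square algebra_simps)
  have shift: "theta 0 (1/2) (z + 1/2) \<tau> =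
      exp (pi * \<i> * \<tau> / 4 + pi * \<i> * (z + 1/2)) * theta 0 0 w \<tau>"
    unfolding theta_def term_eq by (rule infsum_cmult_right')
  have conv: "convergent_prod (\<lambda>n. 1 - (x\<^sup>2) ^ n / \<zeta>)"
    using convergent_prod_qprod[OF q, of "1 / \<zeta>"]
      convergent_prod_iff_shift[of "\<lambda>n. 1 - (x\<^sup>2) ^ n / \<zeta>" 1] by simp
  have shifted_prod: "(\<Prod>n. 1 - (x\<^sup>2) ^ n / \<zeta>) = (1 - 1 / \<zeta>) * qprod (x\<^sup>2) (1 / \<zeta>)"
  proof (rule LIMSEQ_unique)
    show "(\<lambda>N. \<Prod>n<Suc N. 1 - (x\<^sup>2) ^ n / \<zeta>) \<longlonglongrightarrow> (\<Prod>n. 1 - (x\<^sup>2) ^ n / \<zeta>)"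
      by (rule LIMSEQ_Suc[OF prodinf_LIMSEQ_lessThan[OF conv]])
    have "(\<lambda>N. (1 - 1 / \<zeta>) * (\<Prod>n<N. 1 - (x\<^sup>2) ^ Suc n * (1 / \<zeta>)))
        \<longlonglongrightarrow> (1 - 1 / \<zeta>) * qprod (x\<^sup>2) (1 / \<zeta>)"
      unfolding qprod_def
      by (intro tendsto_mult tendsto_const prodinf_LIMSEQ_lessThan convergent_prod_qprod q)
    thus "(\<lambda>N. \<Prod>n<Suc N. 1 - (x\<^sup>2) ^ n / \<zeta>)
        \<longlonglongrightarrow> (1 - 1 / \<zeta>) * qprod (x\<^sup>2) (1 / \<zeta>)"
      by (simp add: prod.lessThan_Suc_shift del: prod.lessThan_Suc)
  qed
  have "(\<Prod>n. (1 + x ^ (2 * n + 1) * (- (x * \<zeta>))) * (1 + x ^ (2 * n + 1) / (- (x * \<zeta>)))) =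
      (\<Prod>n. (1 - (x\<^sup>2) ^ Suc n * \<zeta>) * (1 - (x\<^sup>2) ^ n / \<zeta>))"
    using x_bounds(2) by (intro prodinf_cong) (simp add: power_mult power_mult_distrib power2_eq_square mult_ac)
  also have "\<dots> = qprod (x\<^sup>2) \<zeta> * ((1 - 1 / \<zeta>) * qprod (x\<^sup>2) (1 / \<zeta>))"
    unfolding shifted_prod[symmetric] unfolding qprod_def
    by (rule prodinf_mult[OF convergent_prod_qprod[OF q] conv, symmetric])
  finally have jtp: "theta 0 0 w \<tau> =
      euler (x\<^sup>2) * (qprod (x\<^sup>2) \<zeta> * ((1 - 1 / \<zeta>) * qprod (x\<^sup>2) (1 / \<zeta>)))"
    using jacobi_triple_product[OF \<tau>, of w] unfolding w x_def[symmetric] by simp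
  have "exp (pi * \<i> * (z + 1/2)) * (1 - 1 / \<zeta>) = - 2 * sin (pi * z)"
  proof -
    have "exp (pi * \<i> * (z + 1/2)) = \<i> * exp (\<i> * (pi * z))"
    proof -
      have "exp (pi * \<i> * (z + 1/2)) = exp (\<i> * (pi * z) + \<i> * complex_of_real (pi / 2))"
        by (rule arg_cong[where f = exp]) (simp add: algebra_simps)
      thus ?thesis unfolding exp_add cis_conv_exp[symmetric] cis_pi_half by (simp only: mult.commute)
    qed
    moreover have "exp (\<i> * (pi * z)) / \<zeta> = exp (- (\<i> * (pi * z)))"
      by (simp add: \<zeta>_def exp_minus field_simps flip: exp_add)
    moreover have "\<i> * a * (1 - 1 / \<zeta>) = - 2 * ((a - a / \<zeta>) / (2 * \<i>))" for a
      by (simp add: field_simps)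
    ultimately show ?thesis
      unfolding sin_exp_eq by (simp only:)
  qed
  thus ?thesis
    unfolding shift jtp exp_add \<zeta>_def[symmetric] by algebra
qed

lemma theta1_third:
  "theta 0 (1/2) (1/3 + 1/2) \<tau> = - (sqrt 3 * exp (pi * \<i> * \<tau> / 4) * euler (x ^ 6))"
proof -
  have q: "norm (x\<^sup>2) < 1" using norm_power_x by simp
  define \<omega> where "\<omega> = exp (2 * pi * \<i> * (1/3))"
  have sin_third: "sin (complex_of_real pi * (1/3)) = of_real (sqrt 3 / 2)"
    by (simp only: sin_of_real[symmetric] of_real_mult[symmetric] flip: sin_60) simp
  have prod_third: "euler (x\<^sup>2) * (qprod (x\<^sup>2) \<omega> * qprod (x\<^sup>2) (1 / \<omega>)) = euler (x ^ 6)"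
  proof -
    have eq: "(1 - (x\<^sup>2) ^ Suc n) * ((1 - (x\<^sup>2) ^ Suc n * \<omega>) * (1 - (x\<^sup>2) ^ Suc n * (1 / \<omega>))) =
        1 - (x ^ 6) ^ Suc n" for n
    proof -
      have "(1 - a) * ((1 - a * \<omega>) * (1 - a * (1 / \<omega>))) = 1 - a ^ 3" for a
        proof -
        have "(1 - a * \<omega>) * (1 - a * (1 / \<omega>)) = 1 + a + a\<^sup>2"
          using omega_times(2)[of a] by (simp add: \<omega>_def)
        thus ?thesis by algebra
      qed
      moreover have "((x\<^sup>2) ^ Suc n) ^ 3 = (x ^ 6) ^ Suc n"
        unfolding power_mult[symmetric] by (simp only: mult_ac) simp
      ultimately show ?thesis by metis
    qed
    note conv = convergent_prod_euler[OF q] convergent_prod_qprod[OF q, of \<omega>]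
      convergent_prod_qprod[OF q, of "1 / \<omega>"]
    show ?thesis
      unfolding euler_def qprod_def prodinf_mult[OF conv(2,3)]
        prodinf_mult[OF conv(1) convergent_prod_mult[OF conv(2,3)]] eq ..
  qed
  show ?thesis
    unfolding theta1_product[of "1/3"] \<omega>_def[symmetric] sin_third prod_third by simp
qed

text \<open>
  Jacobi's derivative formula.  The argument is written \<open>0 + 1/2\<close> because it is the value at \<open>z = 0\<close> of the
  derivative of the function \<open>\<lambda>z. theta 0 (1/2) (z + 1/2) \<tau>\<close>.
\<close>

lemma theta1_deriv_0: "theta 1 (1/2) (0 + 1/2) \<tau> = - (2 * complex_of_real pi * exp (pi * \<i> * \<tau> / 4) * euler (x\<^sup>2) ^ 3)"
proof -
  have q: "norm (x\<^sup>2) < 1" using norm_power_x by simp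
  define H where "H = (\<lambda>z. - 2 * exp (pi * \<i> * \<tau> / 4) *
     (euler (x\<^sup>2) * (qprod (x\<^sup>2) (exp (2 * pi * \<i> * z)) * qprod (x\<^sup>2) (1 / exp (2 * pi * \<i> * z)))))"
  have H0: "H 0 = - 2 * exp (pi * \<i> * \<tau> / 4) * euler (x\<^sup>2) ^ 3"
  proof -
    have "qprod (x\<^sup>2) 1 = euler (x\<^sup>2)" by (simp only: qprod_def euler_def mult_1_right)
    thus ?thesis by (simp add: H_def power3_eq_cube)
  qed
  have "isCont H 0"
    unfolding H_def
    by (intro isCont_mult continuous_const
          isCont_o2[of 0 "\<lambda>z. exp (2 * pi * \<i> * z)" "qprod (x\<^sup>2)"]
          isCont_o2[of 0 "\<lambda>z. 1 / exp (2 * pi * \<i> * z)" "qprod (x\<^sup>2)"])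
       (auto intro!: continuous_intros simp: isCont_qprod[OF q])
  have "((\<lambda>z. sin (complex_of_real pi * z)) has_field_derivative pi) (at 0)"
    by (rule derivative_eq_intros refl | simp)+
  then obtain g where g: "\<And>z. sin (complex_of_real pi * z) = g z * z" "isCont g 0" "g 0 = pi"
    unfolding CARAT_DERIV by auto
  have "((\<lambda>z. theta 0 (1/2) (z + 1/2) \<tau>) has_field_derivative pi * H 0) (at 0)"
    unfolding CARAT_DERIV
  proof (intro exI[of _ "\<lambda>z. g z * H z"] conjI allI)
    show "theta 0 (1/2) (z + 1/2) \<tau> - theta 0 (1/2) (0 + 1/2) \<tau> = g z * H z * (z - 0)" for z
      unfolding theta1_product g(1) by (simp add: H_def)
    show "isCont (\<lambda>z. g z * H z) 0" by (rule isCont_mult[OF g(2) \<open>isCont H 0\<close>])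
  qed (simp add: g)
  moreover have "((\<lambda>z. theta 0 (1/2) (z + 1/2) \<tau>) has_field_derivative theta 1 (1/2) (0 + 1/2) \<tau>) (at 0)"
    using DERIV_theta[OF \<tau>, of 0 "1/2" "0 + 1/2"] unfolding DERIV_shift by simp
  ultimately have "theta 1 (1/2) (0 + 1/2) \<tau> = pi * H 0" using DERIV_unique by blast
  thus ?thesis unfolding H0 by simp
qed

lemma theta_nonzero:
  "theta 0 0 0 \<tau> \<noteq> 0" "theta 0 0 (1/3) \<tau> \<noteq> 0"
  "theta 0 (1/2) (1/3 + 1/2) \<tau> \<noteq> 0" "theta 1 (1/2) (0 + 1/2) \<tau> \<noteq> 0"
proof -
  have E: "euler (x ^ n) \<noteq> 0" if "n > 0" for n by (rule euler_nonzero[OF norm_power_x[OF that]])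
  have "odd_prod x * euler (x ^ 1) * euler (x ^ 4) = euler (x ^ 2) ^ 2"
    using odd_prod_eq_euler[OF x_bounds(1)] by simp
  hence O: "odd_prod x \<noteq> 0" using E[of 2] by auto
  have "odd_prod (x ^ 3) * euler (x ^ 3) * euler (x ^ 12) = euler (x ^ 6) ^ 2"
    using odd_prod_eq_euler[OF norm_power_x[of 3]] by (simp flip: power_mult)
  hence O3: "odd_prod (x ^ 3) \<noteq> 0" using E[of 6] by auto
  show "theta 0 0 0 \<tau> \<noteq> 0" using O E[of 2] by (simp add: theta3_0)
  show "theta 0 0 (1/3) \<tau> \<noteq> 0" using theta3_third O3 E[of 2] by auto
  show "theta 0 (1/2) (1/3 + 1/2) \<tau> \<noteq> 0" using E[of 6] unfolding theta1_third by simp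
  show "theta 1 (1/2) (0 + 1/2) \<tau> \<noteq> 0" using E[of 2] unfolding theta1_deriv_0 by simp
qed

text \<open>
  Up to constants all quantities are monomials in \<open>h = exp (\<pi> \<i> \<tau> / 24)\<close> and in the Euler products \<open>E n\<close> of \<open>x ^ n\<close> for
  \<open>n = 1, 2, 3, 4, 6, 12\<close>, so that only exponents and constants have to be compared.
\<close>

lemma u_mod_U_mod_eq_theta:
  shows "u_mod \<tau> = (theta 0 (1/2) (1/3 + 1/2) \<tau> / theta 0 0 (1/3) \<tau>) ^ 4 / 9"
    and "U_mod \<tau> = complex_of_real (sqrt 3) / (2 * complex_of_real pi) * (theta 1 (1/2) (0 + 1/2) \<tau> * theta 0 0 (1/3) \<tau> /
           (theta 0 (1/2) (1/3 + 1/2) \<tau> * theta 0 0 0 \<tau>))"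
proof -
  define h E where "h = exp (pi * \<i> * \<tau> / 24)" and "E = (\<lambda>n. euler (x ^ n))"
  have h: "h \<noteq> 0" by (simp add: h_def)
  have E: "E n \<noteq> 0" if "n > 0" for n
    unfolding E_def by (rule euler_nonzero[OF norm_power_x[OF that]])
  have eta: "dedekind_eta (of_nat n * \<tau> / 2) = h ^ n * E n" for n
  proof -
    have "exp (2 * of_real pi * \<i> * of_nat (Suc k) * (of_nat n * \<tau> / 2)) = (x ^ n) ^ Suc k" for k
      unfolding x_def exp_of_nat_mult[symmetric] by (rule arg_cong[where f = exp]) (simp add: algebra_simps)
    moreover have "exp (2 * of_real pi * \<i> * (of_nat n * \<tau> / 2) / 24) = h ^ n"
      unfolding h_def exp_of_nat_mult[symmetric] by (rule arg_cong[where f = exp]) simp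
    ultimately show ?thesis
      unfolding dedekind_eta_def E_def euler_def by simp
  qed
  have etas: "dedekind_eta (\<tau> / 2) = h * E 1" "dedekind_eta \<tau> = h ^ 2 * E 2"
    "dedekind_eta (3 * \<tau> / 2) = h ^ 3 * E 3" "dedekind_eta (2 * \<tau>) = h ^ 4 * E 4"
    "dedekind_eta (3 * \<tau>) = h ^ 6 * E 6" "dedekind_eta (6 * \<tau>) = h ^ 12 * E 12"
    using eta[of 1] eta[of 2] eta[of 3] eta[of 4] eta[of 6] eta[of 12] by simp_all
  have "odd_prod x * E 1 * E 4 = E 2 ^ 2"
    using odd_prod_eq_euler[OF x_bounds(1)] by (simp add: E_def)
  hence O1: "odd_prod x = E 2 ^ 2 / (E 1 * E 4)"
    using E by (simp add: field_simps)
  have "odd_prod (x ^ 3) * E 3 * E 12 = E 6 ^ 2"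
    using odd_prod_eq_euler[OF norm_power_x[of 3]] by (simp add: E_def flip: power_mult)
  hence O3: "odd_prod (x ^ 3) = E 6 ^ 2 / (E 3 * E 12)"
    using E by (simp add: field_simps)
  have h6: "exp (pi * \<i> * \<tau> / 4) = h ^ 6"
    unfolding h_def exp_of_nat_mult[symmetric] by (rule arg_cong[where f = exp]) simp
  have t3: "theta 0 0 (1/3) \<tau> = E 1 * E 4 * E 6 ^ 2 / (E 2 * E 3 * E 12)"
  proof -
    have "theta 0 0 (1/3) \<tau> * (E 2 ^ 2 / (E 1 * E 4)) = E 2 * (E 6 ^ 2 / (E 3 * E 12))"
      using theta3_third unfolding O1 O3 by (simp add: E_def)
    thus ?thesis using E[of 1] E[of 2] E[of 3] E[of 4] E[of 12]
      by (simp add: field_simps power2_eq_square)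
  qed
  have t1: "theta 0 (1/2) (1/3 + 1/2) \<tau> = - (sqrt 3 * h ^ 6 * E 6)"
    unfolding theta1_third h6 E_def ..
  have t0: "theta 0 0 0 \<tau> = E 2 ^ 5 / (E 1 * E 4) ^ 2"
    unfolding theta3_0 O1 using E[of 2] by (simp add: E_def power_divide eval_nat_numeral)
  have t1': "theta 1 (1/2) (0 + 1/2) \<tau> = - (2 * complex_of_real pi * h ^ 6 * E 2 ^ 3)"
    unfolding theta1_deriv_0 h6 by (simp add: E_def)
  have sqrt3: "complex_of_real (sqrt 3) ^ 4 = 9" "complex_of_real (sqrt 3) \<noteq> 0"
    by (simp_all add: power4_eq_xxxx flip: of_real_mult)
  have nz: "E 1 \<noteq> 0" "E 2 \<noteq> 0" "E 3 \<noteq> 0" "E 4 \<noteq> 0" "E 6 \<noteq> 0" "E 12 \<noteq> 0"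
    using E by simp_all
  show "u_mod \<tau> = (theta 0 (1/2) (1/3 + 1/2) \<tau> / theta 0 0 (1/3) \<tau>) ^ 4 / 9"
    unfolding u_mod_def etas t1 t3 using h nz sqrt3(1) by (rule eta_quotient_u)
  show "U_mod \<tau> = complex_of_real (sqrt 3) / (2 * complex_of_real pi) * (theta 1 (1/2) (0 + 1/2) \<tau> * theta 0 0 (1/3) \<tau> /
           (theta 0 (1/2) (1/3 + 1/2) \<tau> * theta 0 0 0 \<tau>))"
    unfolding U_mod_def etas t1 t3 t0 t1' using h nz sqrt3(2) by (rule eta_quotient_U) simp
qed

end

section \<open>The differential system in the modulus\<close>

lemma theta_pair_thirds_theta:
  assumes \<tau>: "Im \<tau> > 0"
  shows "theta_pair_thirds (\<lambda>k z. theta k 0 z \<tau>) (\<lambda>k z. theta k (1/2) (z + 1/2) \<tau>)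
    (\<lambda>k z. 2 ^ k * theta k 0 (2 * z) (2 * \<tau>)) (\<lambda>k z. 2 ^ k * theta k (1/2) (2 * z) (2 * \<tau>))"
proof
  have \<tau>2: "Im (2 * \<tau>) > 0" using \<tau> by simp
  fix k z
  show "((\<lambda>z. theta k 0 z \<tau>) has_field_derivative theta (Suc k) 0 z \<tau>) (at z)"
    by (rule DERIV_theta[OF \<tau>])
  show "((\<lambda>z. theta k (1/2) (z + 1/2) \<tau>) has_field_derivative theta (Suc k) (1/2) (z + 1/2) \<tau>) (at z)"
    using DERIV_theta[OF \<tau>, of k "1/2" "z + 1/2"] unfolding DERIV_shift .
  have double: "((\<lambda>z. 2 ^ k * theta k d (2 * z) (2 * \<tau>)) has_field_derivative
      2 ^ Suc k * theta (Suc k) d (2 * z) (2 * \<tau>)) (at z)" for d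
    by (rule derivative_eq_intros DERIV_chain2[OF DERIV_theta[OF \<tau>2]] refl | simp)+
  show "((\<lambda>z. 2 ^ k * theta k 0 (2 * z) (2 * \<tau>)) has_field_derivative
      2 ^ Suc k * theta (Suc k) 0 (2 * z) (2 * \<tau>)) (at z)"
    by (rule double)
  show "((\<lambda>z. 2 ^ k * theta k (1/2) (2 * z) (2 * \<tau>)) has_field_derivative
      2 ^ Suc k * theta (Suc k) (1/2) (2 * z) (2 * \<tau>)) (at z)"
    by (rule double)
  show "theta k 0 (- z) \<tau> = (- 1) ^ k * theta k 0 z \<tau>"
    by (rule theta_minus[of _ 0]) simp
  show "theta k 0 (z + 1) \<tau> = theta k 0 z \<tau>"
    by (simp add: theta_plus_1)
  have minus: "theta k (1/2) (w + 1) \<tau> = - theta k (1/2) w \<tau>" for w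
    by (simp add: theta_plus_1 mult.commute)
  show "theta k (1/2) (z + 1 + 1/2) \<tau> = - theta k (1/2) (z + 1/2) \<tau>"
    using minus[of "z + 1/2"] by (simp add: add_ac)
  show "theta k (1/2) (- z + 1/2) \<tau> = - ((- 1) ^ k * theta k (1/2) (z + 1/2) \<tau>)"
  proof -
    have "theta k (1/2) (- (z - 1/2)) \<tau> = (- 1) ^ k * theta k (1/2) (z - 1/2) \<tau>"
      by (rule theta_minus[of _ 1]) simp
    moreover have "theta k (1/2) (z + 1/2) \<tau> = - theta k (1/2) (z - 1/2) \<tau>"
      using minus[of "z - 1/2"] by (simp add: algebra_simps)
    ultimately show ?thesis by simp
  qed
qed (use theta_mult_theta[OF \<tau>] theta_nonzero[OF \<tau>] in simp_all)


text \<open>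
  With \<open>s\<close>, \<open>t\<close> the even and the odd theta function of modulus \<open>\<tau>\<close>, these are \<open>s' (1/3) / s (1/3)\<close>,
  \<open>t' (1/3) / t (1/3)\<close> and \<open>s'' 0 / s 0\<close>.
\<close>

definition \<alpha> :: "complex \<Rightarrow> complex" where
  "\<alpha> \<tau> = theta 1 0 (1/3) \<tau> / theta 0 0 (1/3) \<tau>"

definition \<beta> :: "complex \<Rightarrow> complex" where
  "\<beta> \<tau> = theta 1 (1/2) (1/3 + 1/2) \<tau> / theta 0 (1/2) (1/3 + 1/2) \<tau>"

definition \<xi> :: "complex \<Rightarrow> complex" where
  "\<xi> \<tau> = theta 2 0 0 \<tau> / theta 0 0 0 \<tau>"

text \<open>
  Theta values are differentiated logarithmically: each derivative is stated as the value times a factor.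
\<close>

lemma log_deriv_mult:
  fixes f g :: "complex \<Rightarrow> complex"
  assumes "(f has_field_derivative f x * p) (at x)" "(g has_field_derivative g x * r) (at x)"
  shows "((\<lambda>x. f x * g x) has_field_derivative f x * g x * (p + r)) (at x)"
  by (rule DERIV_cong[OF DERIV_mult[OF assms]]) (simp add: algebra_simps)

lemma log_deriv_divide:
  fixes f g :: "complex \<Rightarrow> complex"
  assumes "(f has_field_derivative f x * p) (at x)" "(g has_field_derivative g x * r) (at x)" "g x \<noteq> 0"
  shows "((\<lambda>x. f x / g x) has_field_derivative f x / g x * (p - r)) (at x)"
  by (rule DERIV_cong[OF DERIV_divide[OF assms]]) (use assms(3) in \<open>simp add: field_simps\<close>)

lemma log_deriv_power:
  fixes f :: "complex \<Rightarrow> complex"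
  assumes "(f has_field_derivative f x * p) (at x)"
  shows "((\<lambda>x. f x ^ n) has_field_derivative f x ^ n * (of_nat n * p)) (at x)"
  by (rule DERIV_cong[OF DERIV_power[OF assms]]) (cases n; simp add: algebra_simps)

lemma log_deriv_cmult:
  fixes f :: "complex \<Rightarrow> complex"
  assumes "(f has_field_derivative f x * p) (at x)"
  shows "((\<lambda>x. k * f x) has_field_derivative k * f x * p) (at x)"
  by (rule DERIV_cong[OF DERIV_cmult[OF assms]]) simp

lemma DERIV_transform_upper_half_plane:
  assumes "(f has_field_derivative D) (at \<tau>)" "Im \<tau> > 0" "\<And>t. Im t > 0 \<Longrightarrow> f t = g t"
  shows "(g has_field_derivative D) (at \<tau>)"
  by (rule has_field_derivative_transform_within_open[OF assms(1) open_halfspace_Im_gt[of 0]])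
     (use assms in auto)

context
  fixes \<tau> :: complex
  assumes \<tau>: "Im \<tau> > 0"
begin

interpretation theta_pair_thirds "\<lambda>k z. theta k 0 z \<tau>" "\<lambda>k z. theta k (1/2) (z + 1/2) \<tau>"
  "\<lambda>k z. 2 ^ k * theta k 0 (2 * z) (2 * \<tau>)" "\<lambda>k z. 2 ^ k * theta k (1/2) (2 * z) (2 * \<tau>)"
  by (rule theta_pair_thirds_theta[OF \<tau>])

text \<open>
  Since \<open>\<alpha>\<close> and \<open>\<alpha> + 2 \<beta>\<close> are theta quotients, their own derivatives follow from those of the theta values, and
  the system closes.
\<close>

lemma theta_quotients:
  "\<alpha> \<tau> = (- 1/3) * (theta 1 (1/2) (0 + 1/2) \<tau> * theta 0 (1/2) (1/3 + 1/2) \<tau> ^ 3 /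
     (theta 0 0 (1/3) \<tau> ^ 3 * theta 0 0 0 \<tau>))"
  "\<alpha> \<tau> + 2 * \<beta> \<tau> = theta 1 (1/2) (0 + 1/2) \<tau> * theta 0 0 (1/3) \<tau> /
     (theta 0 (1/2) (1/3 + 1/2) \<tau> * theta 0 0 0 \<tau>)"
proof -
  have "\<alpha> \<tau> * (3 * (theta 0 0 (1/3) \<tau> ^ 3 * theta 0 0 0 \<tau>)) =
      - (theta 1 (1/2) (0 + 1/2) \<tau> * theta 0 (1/2) (1/3 + 1/2) \<tau> ^ 3)"
    using t_prime_t_third unfolding \<alpha>_def[symmetric] by (simp only: mult_ac)
  thus "\<alpha> \<tau> = (- 1/3) * (theta 1 (1/2) (0 + 1/2) \<tau> * theta 0 (1/2) (1/3 + 1/2) \<tau> ^ 3 /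
     (theta 0 0 (1/3) \<tau> ^ 3 * theta 0 0 0 \<tau>))"
    using nonzero by (simp add: field_simps)
  have "(\<alpha> \<tau> + 2 * \<beta> \<tau>) * (theta 0 (1/2) (1/3 + 1/2) \<tau> * theta 0 0 0 \<tau>) =
      theta 1 (1/2) (0 + 1/2) \<tau> * theta 0 0 (1/3) \<tau>"
    using t_prime_s_third unfolding \<alpha>_def[symmetric] \<beta>_def[symmetric] .
  thus "\<alpha> \<tau> + 2 * \<beta> \<tau> = theta 1 (1/2) (0 + 1/2) \<tau> * theta 0 0 (1/3) \<tau> /
     (theta 0 (1/2) (1/3 + 1/2) \<tau> * theta 0 0 0 \<tau>)"
    by (subst nonzero_eq_divide_eq) (use nonzero in simp_all)
qed

lemma log_deriv_theta:
  "(theta 0 0 0 has_field_derivative theta 0 0 0 \<tau> * (\<xi> \<tau> / (4 * pi * \<i>))) (at \<tau>)"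
  "(theta 0 0 (1/3) has_field_derivative
     theta 0 0 (1/3) \<tau> * ((\<xi> \<tau> - 2 * (\<alpha> \<tau>)\<^sup>2 - 6 * \<alpha> \<tau> * \<beta> \<tau>) / (4 * pi * \<i>))) (at \<tau>)"
  "(theta 0 (1/2) (1/3 + 1/2) has_field_derivative
     theta 0 (1/2) (1/3 + 1/2) \<tau> * ((\<xi> \<tau> - (\<alpha> \<tau>)\<^sup>2 - 4 * \<alpha> \<tau> * \<beta> \<tau> - 3 * (\<beta> \<tau>)\<^sup>2) / (4 * pi * \<i>))) (at \<tau>)"
  "(theta 1 (1/2) (0 + 1/2) has_field_derivative
     theta 1 (1/2) (0 + 1/2) \<tau> * ((3 * \<xi> \<tau> - 3 * (\<alpha> \<tau>)\<^sup>2 - 12 * \<alpha> \<tau> * \<beta> \<tau> - 3 * (\<beta> \<tau>)\<^sup>2) / (4 * pi * \<i>))) (at \<tau>)"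
proof -
  have *: "(theta k d z has_field_derivative theta k d z \<tau> * (p / (4 * pi * \<i>))) (at \<tau>)"
    if "theta (k + 2) d z \<tau> / theta k d z \<tau> = p" "theta k d z \<tau> \<noteq> 0" for k d z p
    using heat_equation_theta[OF \<tau>, of k d z] that(2) unfolding that(1)[symmetric] by simp
  note ratios = heat_ratios[folded \<alpha>_def \<beta>_def \<xi>_def]
  show "(theta 0 0 0 has_field_derivative theta 0 0 0 \<tau> * (\<xi> \<tau> / (4 * pi * \<i>))) (at \<tau>)"
    by (rule *) (simp_all only: \<xi>_def nonzero add_0 not_False_eq_True)
  show "(theta 0 0 (1/3) has_field_derivative
     theta 0 0 (1/3) \<tau> * ((\<xi> \<tau> - 2 * (\<alpha> \<tau>)\<^sup>2 - 6 * \<alpha> \<tau> * \<beta> \<tau>) / (4 * pi * \<i>))) (at \<tau>)"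
    by (rule *) (simp_all only: ratios nonzero add_0 not_False_eq_True)
  show "(theta 0 (1/2) (1/3 + 1/2) has_field_derivative
     theta 0 (1/2) (1/3 + 1/2) \<tau> * ((\<xi> \<tau> - (\<alpha> \<tau>)\<^sup>2 - 4 * \<alpha> \<tau> * \<beta> \<tau> - 3 * (\<beta> \<tau>)\<^sup>2) / (4 * pi * \<i>))) (at \<tau>)"
    by (rule *) (simp_all only: ratios nonzero add_0 not_False_eq_True)
  show "(theta 1 (1/2) (0 + 1/2) has_field_derivative
     theta 1 (1/2) (0 + 1/2) \<tau> * ((3 * \<xi> \<tau> - 3 * (\<alpha> \<tau>)\<^sup>2 - 12 * \<alpha> \<tau> * \<beta> \<tau> - 3 * (\<beta> \<tau>)\<^sup>2) / (4 * pi * \<i>))) (at \<tau>)"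
    by (rule *) (use ratios(3) nonzero in \<open>simp_all add: numeral_3_eq_3\<close>)
qed

end

text \<open>
  The function \<open>4 \<pi> \<i> U' / U\<close>, by lemma \<open>DERIV_U_mod\<close> below.
\<close>

definition log_U :: "complex \<Rightarrow> complex" where
  "log_U \<tau> = 2 * \<xi> \<tau> - 4 * (\<alpha> \<tau>)\<^sup>2 - 14 * \<alpha> \<tau> * \<beta> \<tau>"

context
  fixes \<tau> :: complex
  assumes \<tau>: "Im \<tau> > 0"
begin

lemma DERIV_\<alpha>:
  "(\<alpha> has_field_derivative \<alpha> \<tau> * (2 * \<xi> \<tau> - 6 * \<alpha> \<tau> * \<beta> \<tau> - 12 * (\<beta> \<tau>)\<^sup>2) / (4 * pi * \<i>)) (at \<tau>)"
proof (rule DERIV_transform_upper_half_plane[OF _ \<tau> theta_quotients(1)[symmetric]])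
  let ?f = "\<lambda>t. - 1/3 * (theta 1 (1/2) (0 + 1/2) t * theta 0 (1/2) (1/3 + 1/2) t ^ 3 /
     (theta 0 0 (1/3) t ^ 3 * theta 0 0 0 t))"
  note der = log_deriv_theta[OF \<tau>]
  have nz: "theta 0 0 (1/3) \<tau> ^ 3 * theta 0 0 0 \<tau> \<noteq> 0"
    using theta_nonzero[OF \<tau>] by simp
  show "(?f has_field_derivative \<alpha> \<tau> * (2 * \<xi> \<tau> - 6 * \<alpha> \<tau> * \<beta> \<tau> - 12 * (\<beta> \<tau>)\<^sup>2) / (4 * pi * \<i>)) (at \<tau>)"
    by (rule DERIV_cong[OF log_deriv_cmult[OF log_deriv_divide[OF
            log_deriv_mult[OF der(4) log_deriv_power[OF der(3)]]
            log_deriv_mult[OF log_deriv_power[OF der(2)] der(1)] nz]]],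
        unfold theta_quotients(1)[OF \<tau>, symmetric]) (simp add: field_simps)
qed

lemma DERIV_\<alpha>_plus_2_\<beta>:
  "((\<lambda>t. \<alpha> t + 2 * \<beta> t) has_field_derivative
     (\<alpha> \<tau> + 2 * \<beta> \<tau>) * log_U \<tau> / (4 * pi * \<i>)) (at \<tau>)"
proof (rule DERIV_transform_upper_half_plane[OF _ \<tau> theta_quotients(2)[symmetric]])
  let ?f = "\<lambda>t. theta 1 (1/2) (0 + 1/2) t * theta 0 0 (1/3) t /
     (theta 0 (1/2) (1/3 + 1/2) t * theta 0 0 0 t)"
  note der = log_deriv_theta[OF \<tau>]
  have nz: "theta 0 (1/2) (1/3 + 1/2) \<tau> * theta 0 0 0 \<tau> \<noteq> 0"
    using theta_nonzero[OF \<tau>] by simp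
  show "(?f has_field_derivative (\<alpha> \<tau> + 2 * \<beta> \<tau>) * log_U \<tau> / (4 * pi * \<i>)) (at \<tau>)"
    by (rule DERIV_cong[OF log_deriv_divide[OF
            log_deriv_mult[OF der(4) der(2)] log_deriv_mult[OF der(3) der(1)] nz]],
        unfold theta_quotients(2)[OF \<tau>, symmetric]) (simp add: field_simps log_U_def)
qed

lemma DERIV_\<beta>:
  "(\<beta> has_field_derivative
     ((\<alpha> \<tau> + 2 * \<beta> \<tau>) * log_U \<tau> - \<alpha> \<tau> * (2 * \<xi> \<tau> - 6 * \<alpha> \<tau> * \<beta> \<tau> - 12 * (\<beta> \<tau>)\<^sup>2)) / (8 * pi * \<i>)) (at \<tau>)"
  using DERIV_cdivide[OF DERIV_diff[OF DERIV_\<alpha>_plus_2_\<beta> DERIV_\<alpha>], of 2]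
  by (simp add: diff_divide_distrib mult.assoc)

text \<open>
  The product of the quotient for \<open>\<alpha>\<close> and the cube of the quotient for \<open>\<alpha> + 2 \<beta>\<close>: the values at \<open>1/3\<close> cancel.
\<close>

lemma t_prime_fourth_power:
  "(theta 1 (1/2) (0 + 1/2) \<tau> / theta 0 0 0 \<tau>) ^ 4 = - 3 * \<alpha> \<tau> * (\<alpha> \<tau> + 2 * \<beta> \<tau>) ^ 3"
  unfolding theta_quotients(2)[OF \<tau>] unfolding theta_quotients(1)[OF \<tau>]
  using theta_nonzero[OF \<tau>]
  by (simp add: field_simps eval_nat_numeral)

lemma DERIV_\<xi>:
  "(\<xi> has_field_derivative (2 * (\<xi> \<tau>)\<^sup>2 - 6 * \<alpha> \<tau> * (\<alpha> \<tau> + 2 * \<beta> \<tau>) ^ 3) / (4 * pi * \<i>)) (at \<tau>)"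
proof -
  interpret theta_pair_thirds "\<lambda>k z. theta k 0 z \<tau>" "\<lambda>k z. theta k (1/2) (z + 1/2) \<tau>"
    "\<lambda>k z. 2 ^ k * theta k 0 (2 * z) (2 * \<tau>)" "\<lambda>k z. 2 ^ k * theta k (1/2) (2 * z) (2 * \<tau>)"
    by (rule theta_pair_thirds_theta[OF \<tau>])
  have "theta 4 0 0 \<tau> / theta 0 0 0 \<tau> = 3 * (\<xi> \<tau>)\<^sup>2 - 6 * \<alpha> \<tau> * (\<alpha> \<tau> + 2 * \<beta> \<tau>) ^ 3"
    using s_fourth_derivative_at_0[OF theta_nonzero(1)[OF \<tau>]]
    unfolding t_prime_fourth_power \<xi>_def[symmetric] by simp
  hence e4: "theta 4 0 0 \<tau> = (3 * (\<xi> \<tau>)\<^sup>2 - 6 * \<alpha> \<tau> * (\<alpha> \<tau> + 2 * \<beta> \<tau>) ^ 3) * theta 0 0 0 \<tau>"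
    using theta_nonzero(1)[OF \<tau>] by (simp add: field_simps)
  have e2: "theta 2 0 0 \<tau> = \<xi> \<tau> * theta 0 0 0 \<tau>"
    using theta_nonzero(1)[OF \<tau>] by (simp add: \<xi>_def)
  have "((\<lambda>t. theta 2 0 0 t / theta 0 0 0 t) has_field_derivative
      (theta 4 0 0 \<tau> / (4 * pi * \<i>) * theta 0 0 0 \<tau> - theta 2 0 0 \<tau> * (theta 2 0 0 \<tau> / (4 * pi * \<i>)))
        / (theta 0 0 0 \<tau> * theta 0 0 0 \<tau>)) (at \<tau>)"
    using DERIV_divide[OF heat_equation_theta[OF \<tau>] heat_equation_theta[OF \<tau>] theta_nonzero(1)[OF \<tau>], of 2 0 0]
    by (simp del: add_2_eq_Suc')
  hence "(\<xi> has_field_derivative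
      (theta 4 0 0 \<tau> / (4 * pi * \<i>) * theta 0 0 0 \<tau> - theta 2 0 0 \<tau> * (theta 2 0 0 \<tau> / (4 * pi * \<i>)))
        / (theta 0 0 0 \<tau> * theta 0 0 0 \<tau>)) (at \<tau>)"
    unfolding \<xi>_def[abs_def] .
  thus ?thesis
    by (rule DERIV_cong)
       (use theta_nonzero(1)[OF \<tau>] in \<open>simp add: e4 e2 divide_simps power2_eq_square, simp add: algebra_simps\<close>)
qed

text \<open>
  In \<open>4 \<pi> \<i>\<close> times the derivative the terms containing \<open>\<xi>\<close> are exactly those of \<open>(log_U \<tau>)\<^sup>2\<close>; the
  remainder is a quartic form in \<open>\<alpha>\<close>, \<open>\<beta>\<close> that splits into linear factors.
\<close>

lemma DERIV_log_U_quartic: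
  "(log_U has_field_derivative
     ((log_U \<tau>)\<^sup>2 + 24 * \<alpha> \<tau> * \<beta> \<tau> * (\<alpha> \<tau> + 3 * \<beta> \<tau>) * (\<beta> \<tau> - \<alpha> \<tau>)) / (4 * pi * \<i>)) (at \<tau>)"
  unfolding log_U_def[abs_def]
  by (rule derivative_eq_intros DERIV_\<xi> DERIV_\<alpha> DERIV_\<beta> refl)+
     (simp add: log_U_def field_simps power2_eq_square power3_eq_cube)

lemma \<alpha>_plus_2_\<beta>_nonzero: "\<alpha> \<tau> + 2 * \<beta> \<tau> \<noteq> 0"
  unfolding theta_quotients(2)[OF \<tau>] using theta_nonzero[OF \<tau>] by simp

lemma u_mod_eq: "u_mod \<tau> = - \<alpha> \<tau> / (3 * (\<alpha> \<tau> + 2 * \<beta> \<tau>))"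
  unfolding theta_quotients(2)[OF \<tau>] u_mod_U_mod_eq_theta(1)[OF \<tau>]
  unfolding theta_quotients(1)[OF \<tau>] using theta_nonzero[OF \<tau>]
  by (simp add: field_simps eval_nat_numeral)

lemma U_mod_eq: "U_mod \<tau> = sqrt 3 / (2 * pi) * (\<alpha> \<tau> + 2 * \<beta> \<tau>)"
  unfolding theta_quotients(2)[OF \<tau>] u_mod_U_mod_eq_theta(2)[OF \<tau>] by simp

text \<open>
  With \<open>u_mod_eq\<close> and \<open>U_mod_eq\<close> these values identify each linear factor in \<open>DERIV_log_U_quartic\<close> as a constant
  multiple of \<open>U\<close> times one of \<open>u\<close>, \<open>1 + u\<close>, \<open>1 + 3 u\<close>, \<open>1 + 9 u\<close>.
\<close>

lemma one_plus_u_mod: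
  "1 + u_mod \<tau> = 2 * (\<alpha> \<tau> + 3 * \<beta> \<tau>) / (3 * (\<alpha> \<tau> + 2 * \<beta> \<tau>))"
  "1 + 3 * u_mod \<tau> = 2 * \<beta> \<tau> / (\<alpha> \<tau> + 2 * \<beta> \<tau>)"
  "1 + 9 * u_mod \<tau> = 2 * (\<beta> \<tau> - \<alpha> \<tau>) / (\<alpha> \<tau> + 2 * \<beta> \<tau>)"
proof -
  define g where "g = \<alpha> \<tau> + 2 * \<beta> \<tau>"
  have \<beta>: "\<beta> \<tau> = (g - \<alpha> \<tau>) / 2" by (simp add: g_def)
  have "g \<noteq> 0" using \<alpha>_plus_2_\<beta>_nonzero by (simp add: g_def)
  thus "1 + u_mod \<tau> = 2 * (\<alpha> \<tau> + 3 * \<beta> \<tau>) / (3 * (\<alpha> \<tau> + 2 * \<beta> \<tau>))"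
    "1 + 3 * u_mod \<tau> = 2 * \<beta> \<tau> / (\<alpha> \<tau> + 2 * \<beta> \<tau>)"
    "1 + 9 * u_mod \<tau> = 2 * (\<beta> \<tau> - \<alpha> \<tau>) / (\<alpha> \<tau> + 2 * \<beta> \<tau>)"
    unfolding u_mod_eq g_def[symmetric] unfolding \<beta> by (simp_all add: field_simps)
qed

lemma U_mod_square: "(U_mod \<tau>)\<^sup>2 = 3 * (\<alpha> \<tau> + 2 * \<beta> \<tau>)\<^sup>2 / (4 * pi\<^sup>2)"
proof -
  have "complex_of_real (sqrt 3) ^ 2 = 3" by (simp flip: of_real_power)
  thus ?thesis unfolding U_mod_eq by (simp add: power_mult_distrib power_divide)
qed

end

text \<open>
  In this form of the differential system \<open>\<alpha>\<close>, \<open>\<beta>\<close>, \<open>\<xi>\<close> are eliminated in favour of \<open>u\<close>, \<open>U\<close> and the logarithmic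
  derivative of \<open>U\<close>.
\<close>

lemma DERIV_U_mod:
  assumes \<tau>: "Im \<tau> > 0"
  shows "(U_mod has_field_derivative U_mod \<tau> * log_U \<tau> / (4 * pi * \<i>)) (at \<tau>)"
proof (rule DERIV_transform_upper_half_plane[OF _ \<tau> U_mod_eq[symmetric]])
  show "((\<lambda>t. sqrt 3 / (2 * pi) * (\<alpha> t + 2 * \<beta> t)) has_field_derivative
      U_mod \<tau> * log_U \<tau> / (4 * pi * \<i>)) (at \<tau>)"
    unfolding U_mod_eq[OF \<tau>]
    by (rule DERIV_cong[OF DERIV_cmult[OF DERIV_\<alpha>_plus_2_\<beta>[OF \<tau>]]]) simp
qed

lemma DERIV_u_mod:
  assumes \<tau>: "Im \<tau> > 0"
  shows "(u_mod has_field_derivative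
    - 4 * pi\<^sup>2 * (U_mod \<tau>)\<^sup>2 * (u_mod \<tau> * (1 + u_mod \<tau>) * (1 + 9 * u_mod \<tau>)) / (4 * pi * \<i>)) (at \<tau>)"
proof (rule DERIV_transform_upper_half_plane[OF _ \<tau> u_mod_U_mod_eq_theta(1)[symmetric]])
  let ?a = "\<alpha> \<tau>" and ?b = "\<beta> \<tau>"
  have eq: "4 * (?a - ?b) * (?a + 3 * ?b) =
      - 4 * pi\<^sup>2 * (U_mod \<tau>)\<^sup>2 * ((1 + u_mod \<tau>) * (1 + 9 * u_mod \<tau>))"
    unfolding one_plus_u_mod[OF \<tau>] U_mod_square[OF \<tau>] using \<alpha>_plus_2_\<beta>_nonzero[OF \<tau>]
    by (simp add: divide_simps power2_eq_square) algebra
  note der = log_deriv_theta[OF \<tau>]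
  have "((\<lambda>t. 1 / 9 * (theta 0 (1/2) (1/3 + 1/2) t / theta 0 0 (1/3) t) ^ 4) has_field_derivative
      u_mod \<tau> * (4 * (?a - ?b) * (?a + 3 * ?b)) / (4 * pi * \<i>)) (at \<tau>)"
    unfolding u_mod_U_mod_eq_theta(1)[OF \<tau>]
    by (rule DERIV_cong[OF log_deriv_cmult[OF log_deriv_power[OF
            log_deriv_divide[OF der(3) der(2) theta_nonzero(2)[OF \<tau>]]]]])
       (simp add: divide_simps power2_eq_square, algebra)
  thus "((\<lambda>t. (theta 0 (1/2) (1/3 + 1/2) t / theta 0 0 (1/3) t) ^ 4 / 9) has_field_derivative
      - 4 * pi\<^sup>2 * (U_mod \<tau>)\<^sup>2 * (u_mod \<tau> * (1 + u_mod \<tau>) * (1 + 9 * u_mod \<tau>)) / (4 * pi * \<i>)) (at \<tau>)"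
    unfolding eq by (simp add: mult_ac)
qed

lemma DERIV_log_U:
  assumes \<tau>: "Im \<tau> > 0"
  shows "(log_U has_field_derivative
    ((log_U \<tau>)\<^sup>2 - 48 * pi ^ 4 * (U_mod \<tau>) ^ 4 *
      (u_mod \<tau> * (1 + u_mod \<tau>) * (1 + 3 * u_mod \<tau>) * (1 + 9 * u_mod \<tau>))) / (4 * pi * \<i>)) (at \<tau>)"
proof -
  let ?a = "\<alpha> \<tau>" and ?b = "\<beta> \<tau>"
  have U4: "(U_mod \<tau>) ^ 4 = 9 * (?a + 2 * ?b) ^ 4 / (16 * pi ^ 4)"
    using arg_cong[OF U_mod_square[OF \<tau>], of "\<lambda>y. y\<^sup>2"]
    by (simp add: power_divide power_mult_distrib flip: power_mult)
  have "- 48 * pi ^ 4 * (9 * g ^ 4 / (16 * pi ^ 4)) * (- ?a / (3 * g) * (2 * (?a + 3 * ?b) / (3 * g))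
      * (2 * ?b / g) * (2 * (?b - ?a) / g)) = 24 * ?a * ?b * (?a + 3 * ?b) * (?b - ?a)"
    if "g \<noteq> 0" for g :: complex
    using that by (simp add: divide_simps eval_nat_numeral) (simp add: algebra_simps)
  hence eq: "- 48 * pi ^ 4 * (U_mod \<tau>) ^ 4 *
      (u_mod \<tau> * (1 + u_mod \<tau>) * (1 + 3 * u_mod \<tau>) * (1 + 9 * u_mod \<tau>)) =
      24 * ?a * ?b * (?a + 3 * ?b) * (?b - ?a)"
    unfolding U4 one_plus_u_mod[OF \<tau>] unfolding u_mod_eq[OF \<tau>]
    using \<alpha>_plus_2_\<beta>_nonzero[OF \<tau>] by blast
  show ?thesis
    using DERIV_log_U_quartic[OF \<tau>] unfolding eq[symmetric] by simp
qed

section \<open>Heun's equation\<close>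

theorem theorem11p2:
  fixes T :: "complex \<Rightarrow> complex" and W :: "complex set"
  assumes "local_hol_inverse u_mod T W"
  shows "(\<lambda>w. U_mod (T w)) holomorphic_on W \<and>
         (\<forall>w\<in>W. heun_equation_at (\<lambda>w. U_mod (T w)) w)"
proof -
  have W: "open W" and T: "T holomorphic_on W" and im: "\<And>w. w \<in> W \<Longrightarrow> Im (T w) > 0"
    and inv: "\<And>w. w \<in> W \<Longrightarrow> u_mod (T w) = w"
    using assms by (auto simp: local_hol_inverse_def upper_half_plane_def)
  define V where "V = (\<lambda>w. U_mod (T w))"
  define Q where "Q = (\<lambda>w :: complex. w * (1 + w) * (1 + 9 * w))"
  define \<Psi> where "\<Psi> = (\<lambda>\<tau>. - log_U \<tau> / (4 * pi\<^sup>2 * U_mod \<tau>))"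
  define c where "c = 4 * pi * \<i>"
  have c: "c \<noteq> 0" by (simp add: c_def)
  note DERIV_u = DERIV_u_mod[folded c_def] and DERIV_U = DERIV_U_mod[folded c_def]
    and DERIV_L = DERIV_log_U[folded c_def]
  have DERIV_T: "(T has_field_derivative deriv T w) (at w)" if "w \<in> W" for w
    using holomorphic_derivI[OF T W that] .
  \<comment> \<open>The chain rule for \<open>u_mod (T w) = w\<close>.  In particular no factor on the left vanishes, which excludes the
      singular points of the equation.\<close>
  have deriv_T: "- 4 * pi\<^sup>2 * (V w)\<^sup>2 * Q w / c * deriv T w = 1" if w: "w \<in> W" for w
  proof (rule DERIV_unique)
    show "((\<lambda>w. u_mod (T w)) has_field_derivative - 4 * pi\<^sup>2 * (V w)\<^sup>2 * Q w / c * deriv T w) (at w)"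
      using DERIV_chain2[OF DERIV_u[OF im[OF w]] DERIV_T[OF w]] by (simp add: inv[OF w] V_def Q_def)
    show "((\<lambda>w. u_mod (T w)) has_field_derivative 1) (at w)"
      by (rule has_field_derivative_transform_within_open[OF DERIV_ident W w]) (simp add: inv)
  qed
  have nz: "Q w \<noteq> 0" "V w \<noteq> 0" if "w \<in> W" for w
    using deriv_T[OF that] by auto
  have T': "deriv T w = - c / (4 * pi\<^sup>2 * (V w)\<^sup>2 * Q w)" if "w \<in> W" for w
    using deriv_T[OF that] nz[OF that] c by (simp add: divide_simps, simp add: minus_equation_iff[of _ c] mult_ac)
  have \<Psi>_eq: "\<Psi> (T w) = - log_U (T w) / (4 * pi\<^sup>2 * V w)" for w
    by (simp add: \<Psi>_def V_def)
  \<comment> \<open>\<open>\<Psi> \<circ> T\<close> is the quasi-derivative \<open>Q * V'\<close>, and its derivative is a multiple of \<open>V\<close>.\<close>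
  have DERIV_V: "(V has_field_derivative \<Psi> (T w) / Q w) (at w)" if w: "w \<in> W" for w
  proof -
    have "(V has_field_derivative V w * log_U (T w) / c * deriv T w) (at w)"
      unfolding V_def by (rule DERIV_chain2[OF DERIV_U[OF im[OF w]] DERIV_T[OF w]])
    thus ?thesis
      by (rule DERIV_cong, unfold T'[OF w] \<Psi>_eq)
         (use nz[OF w] c in \<open>simp add: divide_simps power2_eq_square\<close>)
  qed
  have DERIV_\<Psi>: "((\<lambda>w. \<Psi> (T w)) has_field_derivative - 3 * (1 + 3 * w) * V w) (at w)" if w: "w \<in> W" for w
  proof -
    define u L where "u = V w" and "L = log_U (T w)"
    have "u \<noteq> 0" using nz[OF w] by (simp add: u_def)
    have "(\<Psi> has_field_derivative 12 * pi\<^sup>2 * u ^ 3 * (Q w * (1 + 3 * w)) / c) (at (T w))"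
    proof -
      have "4 * pi\<^sup>2 * U_mod (T w) \<noteq> 0" using nz(2)[OF w] by (simp add: V_def)
      note DERIV_divide[OF DERIV_minus[OF DERIV_L[OF im[OF w]]] DERIV_cmult[OF DERIV_U[OF im[OF w]]] this]
      thus ?thesis
        unfolding \<Psi>_def inv[OF w]
        by (rule DERIV_cong)
           (use \<open>u \<noteq> 0\<close> c in \<open>simp add: u_def V_def Q_def divide_simps, simp add: algebra_simps eval_nat_numeral\<close>)
    qed
    from DERIV_chain2[OF this DERIV_T[OF w]] show ?thesis
      by (rule DERIV_cong, unfold T'[OF w] u_def)
        (use nz[OF w] c in \<open>simp add: divide_simps, simp add: power2_eq_square power3_eq_cube algebra_simps\<close>)
  qed
  have "heun_equation_at V w" if w: "w \<in> W" for w
  proof -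
    have w_nz: "w \<noteq> 0" "1 + w \<noteq> 0" "1 + 9 * w \<noteq> 0" using nz(1)[OF w] by (auto simp: Q_def)
    have dV: "deriv V w = \<Psi> (T w) / Q w" using DERIV_V[OF w] by (rule DERIV_imp_deriv)
    have "(Q has_field_derivative (1 + w) * (1 + 9 * w) + w * (1 + 9 * w) + 9 * w * (1 + w)) (at w)"
      unfolding Q_def by (rule derivative_eq_intros refl | simp add: algebra_simps)+
    note DERIV_divide[OF DERIV_\<Psi>[OF w] this nz(1)[OF w]]
    hence "(deriv V has_field_derivative (- 3 * (1 + 3 * w) * V w * Q w -
        \<Psi> (T w) * ((1 + w) * (1 + 9 * w) + w * (1 + 9 * w) + 9 * w * (1 + w))) / (Q w * Q w)) (at w)"
      by (rule has_field_derivative_transform_within_open[OF _ W w])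
         (simp add: DERIV_imp_deriv[OF DERIV_V])
    hence ddV: "deriv (deriv V) w = (- 3 * (1 + 3 * w) * V w * Q w -
        \<Psi> (T w) * ((1 + w) * (1 + 9 * w) + w * (1 + 9 * w) + 9 * w * (1 + w))) / (Q w * Q w)"
      by (rule DERIV_imp_deriv)
    have ninth: "w + 1 / 9 = (1 + 9 * w) / 9" "w + 1 = 1 + w" "w + 1 / 3 = (1 + 3 * w) / 3" by simp_all
    show ?thesis
      unfolding heun_equation_at_def ddV dV ninth Q_def
      using w_nz by (simp add: divide_simps) algebra
  qed
  moreover have "V holomorphic_on W"
    using DERIV_V by (auto simp: holomorphic_on_open[OF W])
  ultimately show ?thesis unfolding V_def by blast
qed

end
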